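(* Let $I$ be the pullback shape category $\{\bullet\to\bullet\leftarrow\bullet\}$. Let $\mathcal{A}$ be the $2$-category generated by objects $X,L,A,B,C$; morphisms $f,g\colon X\to L$, $\lambda_0\colon L\to B$, $\lambda_1\colon L\to C$, $b\colon B\to A$, $c\colon C\to A$; and an invertible $2$-morphism $\alpha\colon f\Rightarrow g$; subject to the relation $b\lambda_0=c\lambda_1$. Let $F\colon I\to\mathcal{A}$ be the diagram $B\xrightarrow{b}A\xleftarrow{c}C$, and let $\lambda\colon\Delta L\Rightarrow F$ be the $2$-cone with components $\lambda_0$ at $B$, $\lambda_1$ at $C$ and $b\lambda_0=c\lambda_1$ at $A$. Then $(L,\lambda)$ is the $2$-limit of $F$, but it is not $2$-terminal in the pseudo-slice $\Delta\downarrow_p F$ of $2$-cones over $F$.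
   Context: $2$-categories and $2$-functors are strict; $*$ denotes horizontal composition (and whiskering) of $2$-morphisms and juxtaposition denotes vertical composition. "Generated by the data subject to relations" means the $2$-category freely generated by the listed objects, morphisms and $2$-morphisms (with a formal inverse adjoined for each $2$-morphism declared invertible), modulo the listed relations. The $1$-category $I$ is regarded as a $2$-category with only identity $2$-morphisms. A $2$-natural transformation $\mu\colon F\Rightarrow G$ between $2$-functors $F,G\colon I\to\mathcal{A}$ consists of morphisms $\mu_i\colon Fi\to Gi$ with $(Gf)\mu_i=\mu_j(Ff)$ for every $f\colon i\to j$ in $I$ and $G\alpha*\mu_i=\mu_j*F\alpha$ for every $2$-morphism $\alpha$ in $I$. A modification $\varphi\colon\mu\to\nu$ consists of $2$-morphisms $\varphi_i\colon\mu_i\Rightarrow\nu_i$ with $Gf*\varphi_i=\varphi_j*Ff$ for every $f\colon i\to j$. $[I,\mathcal{A}]$ is the $2$-category of $2$-functors, $2$-natural transformations and modifications; $\Delta X$ is the constant $2$-functor at $X$; a $2$-cone over $F$ is a $2$-natural transformation $\Delta X\Rightarrow F$. A $2$-limit of $F$ is a pair $(L,\lambda\colon\Delta L\Rightarrow F)$ with $\lambda$ a $2$-cone such that for each $X\in\mathcal{A}$ the functor $\lambda_*\circ\Delta\colon\mathcal{A}(X,L)\to[I,\mathcal{A}](\Delta X,F)$, given by post-composition with $\lambda$, is an isomorphism of categories. The pseudo-slice $\Delta\downarrow_p F$ of $2$-cones is the $2$-category whose objects are pairs $(X,\mu)$ with $\mu\colon\Delta X\Rightarrow F$ a $2$-cone;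 morphisms $(X,\mu)\to(Y,\nu)$ are pairs $(f,\varphi)$ of a morphism $f\colon X\to Y$ in $\mathcal{A}$ and an invertible modification $\varphi\colon\nu\Delta f\to\mu$; $2$-morphisms $(f,\varphi)\Rightarrow(g,\psi)$ are $2$-morphisms $\alpha\colon f\Rightarrow g$ in $\mathcal{A}$ with $\psi(\nu*\Delta\alpha)=\varphi$. An object $L$ of a $2$-category $\mathcal{B}$ is $2$-terminal if for all $X\in\mathcal{B}$ the category $\mathcal{B}(X,L)$ is isomorphic to the terminal category $\mathbb{1}$. *)

theory Defs
  imports "HOL-Library.FuncSet"
begin

section \<open>Categories and isomorphisms of categories\<close>

record ('o, 'm) cat =
  Ob :: "'o set"
  Ar :: "'m set"
  dm :: "'m \<Rightarrow> 'o"
  cd :: "'m \<Rightarrow> 'o"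
  ide :: "'o \<Rightarrow> 'm"
  cmp :: "'m \<Rightarrow> 'm \<Rightarrow> 'm"

locale category =
  fixes C :: "('o, 'm) cat"
  assumes dm_Ob: "f \<in> Ar C \<Longrightarrow> dm C f \<in> Ob C"
    and cd_Ob: "f \<in> Ar C \<Longrightarrow> cd C f \<in> Ob C"
    and ide_Ar: "x \<in> Ob C \<Longrightarrow> ide C x \<in> Ar C \<and> dm C (ide C x) = x \<and> cd C (ide C x) = x"
    and cmp_Ar: "\<lbrakk>f \<in> Ar C; g \<in> Ar C; dm C g = cd C f\<rbrakk> \<Longrightarrow>
        cmp C g f \<in> Ar C \<and> dm C (cmp C g f) = dm C f \<and> cd C (cmp C g f) = cd C g"
    and cmp_ide_left: "f \<in> Ar C \<Longrightarrow> cmp C (ide C (cd C f)) f = f"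
    and cmp_ide_right: "f \<in> Ar C \<Longrightarrow> cmp C f (ide C (dm C f)) = f"
    and cmp_assoc: "\<lbrakk>f \<in> Ar C; g \<in> Ar C; h \<in> Ar C; dm C g = cd C f; dm C h = cd C g\<rbrakk> \<Longrightarrow>
        cmp C h (cmp C g f) = cmp C (cmp C h g) f"

locale cat_functor =
  fixes C :: "('o, 'm) cat" and D :: "('p, 'n) cat" and F0 :: "'o \<Rightarrow> 'p" and F1 :: "'m \<Rightarrow> 'n"
  assumes map_Ob: "x \<in> Ob C \<Longrightarrow> F0 x \<in> Ob D"
    and map_Ar: "f \<in> Ar C \<Longrightarrow>
        F1 f \<in> Ar D \<and> dm D (F1 f) = F0 (dm C f) \<and> cd D (F1 f) = F0 (cd C f)"
    and map_ide: "x \<in> Ob C \<Longrightarrow> F1 (ide C x) = ide D (F0 x)"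
    and map_cmp: "\<lbrakk>f \<in> Ar C; g \<in> Ar C; dm C g = cd C f\<rbrakk> \<Longrightarrow>
        F1 (cmp C g f) = cmp D (F1 g) (F1 f)"

definition cat_iso :: "('o, 'm) cat \<Rightarrow> ('p, 'n) cat \<Rightarrow> ('o \<Rightarrow> 'p) \<Rightarrow> ('m \<Rightarrow> 'n) \<Rightarrow> bool" where
  "cat_iso C D F0 F1 \<longleftrightarrow> cat_functor C D F0 F1 \<and>
     (\<exists>G0 G1. cat_functor D C G0 G1 \<and>
        (\<forall>x\<in>Ob C. G0 (F0 x) = x) \<and> (\<forall>f\<in>Ar C. G1 (F1 f) = f) \<and>
        (\<forall>y\<in>Ob D. F0 (G0 y) = y) \<and> (\<forall>g\<in>Ar D. F1 (G1 g) = g))"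

definition isomorphic_cat :: "('o, 'm) cat \<Rightarrow> ('p, 'n) cat \<Rightarrow> bool" where
  "isomorphic_cat C D \<longleftrightarrow> (\<exists>F0 F1. cat_iso C D F0 F1)"

definition terminal_cat :: "(unit, unit) cat" where
  "terminal_cat = \<lparr>Ob = UNIV, Ar = UNIV, dm = (\<lambda>f. f), cd = (\<lambda>f. f), ide = (\<lambda>x. x), cmp = (\<lambda>g f. ())\<rparr>"


section \<open>Strict 2-categories\<close>

record ('o, 'm, 'c) twocat =
  Obj :: "'o set"
  Mor :: "'m set"
  Cell :: "'c set"
  Dom :: "'m \<Rightarrow> 'o"
  Cod :: "'m \<Rightarrow> 'o"
  Src :: "'c \<Rightarrow> 'm"
  Tgt :: "'c \<Rightarrow> 'm"
  Id1 :: "'o \<Rightarrow> 'm"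
  Comp :: "'m \<Rightarrow> 'm \<Rightarrow> 'm" (infixl \<open>\<odot>\<index>\<close> 70)
  Id2 :: "'m \<Rightarrow> 'c"
  VComp :: "'c \<Rightarrow> 'c \<Rightarrow> 'c" (infixl \<open>\<cdot>\<index>\<close> 68)
  HComp :: "'c \<Rightarrow> 'c \<Rightarrow> 'c" (infixl \<open>\<star>\<index>\<close> 70)

text \<open>All compositions are written in the order of composition of functions.\<close>

locale two_category =
  fixes A :: "('o, 'm, 'c) twocat" (structure)
  assumes Dom_Obj: "f \<in> Mor A \<Longrightarrow> Dom A f \<in> Obj A"
    and Cod_Obj: "f \<in> Mor A \<Longrightarrow> Cod A f \<in> Obj A"
    and Id1_Mor: "x \<in> Obj A \<Longrightarrow> Id1 A x \<in> Mor A \<and> Dom A (Id1 A x) = x \<and> Cod A (Id1 A x) = x"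
    and Comp_Mor: "\<lbrakk>f \<in> Mor A; g \<in> Mor A; Dom A g = Cod A f\<rbrakk> \<Longrightarrow>
        g \<odot> f \<in> Mor A \<and> Dom A (g \<odot> f) = Dom A f \<and> Cod A (g \<odot> f) = Cod A g"
    and Comp_Id1_left: "f \<in> Mor A \<Longrightarrow> Id1 A (Cod A f) \<odot> f = f"
    and Comp_Id1_right: "f \<in> Mor A \<Longrightarrow> f \<odot> Id1 A (Dom A f) = f"
    and Comp_assoc: "\<lbrakk>f \<in> Mor A; g \<in> Mor A; h \<in> Mor A; Dom A g = Cod A f; Dom A h = Cod A g\<rbrakk> \<Longrightarrow>
        h \<odot> (g \<odot> f) = h \<odot> g \<odot> f"
    and Cell_boundary: "\<alpha> \<in> Cell A \<Longrightarrow> Src A \<alpha> \<in> Mor A \<and> Tgt A \<alpha> \<in> Mor A \<and>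
        Dom A (Src A \<alpha>) = Dom A (Tgt A \<alpha>) \<and> Cod A (Src A \<alpha>) = Cod A (Tgt A \<alpha>)"
    and Id2_Cell: "f \<in> Mor A \<Longrightarrow> Id2 A f \<in> Cell A \<and> Src A (Id2 A f) = f \<and> Tgt A (Id2 A f) = f"
    and VComp_Cell: "\<lbrakk>\<alpha> \<in> Cell A; \<beta> \<in> Cell A; Src A \<beta> = Tgt A \<alpha>\<rbrakk> \<Longrightarrow>
        \<beta> \<cdot> \<alpha> \<in> Cell A \<and> Src A (\<beta> \<cdot> \<alpha>) = Src A \<alpha> \<and> Tgt A (\<beta> \<cdot> \<alpha>) = Tgt A \<beta>"
    and VComp_Id2_left: "\<alpha> \<in> Cell A \<Longrightarrow> Id2 A (Tgt A \<alpha>) \<cdot> \<alpha> = \<alpha>"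
    and VComp_Id2_right: "\<alpha> \<in> Cell A \<Longrightarrow> \<alpha> \<cdot> Id2 A (Src A \<alpha>) = \<alpha>"
    and VComp_assoc: "\<lbrakk>\<alpha> \<in> Cell A; \<beta> \<in> Cell A; \<gamma> \<in> Cell A; Src A \<beta> = Tgt A \<alpha>; Src A \<gamma> = Tgt A \<beta>\<rbrakk> \<Longrightarrow>
        \<gamma> \<cdot> (\<beta> \<cdot> \<alpha>) = \<gamma> \<cdot> \<beta> \<cdot> \<alpha>"
    and HComp_Cell: "\<lbrakk>\<alpha> \<in> Cell A; \<beta> \<in> Cell A; Dom A (Src A \<beta>) = Cod A (Src A \<alpha>)\<rbrakk> \<Longrightarrow>
        \<beta> \<star> \<alpha> \<in> Cell A \<and> Src A (\<beta> \<star> \<alpha>) = Src A \<beta> \<odot> Src A \<alpha> \<and> Tgt A (\<beta> \<star> \<alpha>) = Tgt A \<beta> \<odot> Tgt A \<alpha>"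
    and HComp_Id_left: "\<alpha> \<in> Cell A \<Longrightarrow> Id2 A (Id1 A (Cod A (Src A \<alpha>))) \<star> \<alpha> = \<alpha>"
    and HComp_Id_right: "\<alpha> \<in> Cell A \<Longrightarrow> \<alpha> \<star> Id2 A (Id1 A (Dom A (Src A \<alpha>))) = \<alpha>"
    and HComp_assoc: "\<lbrakk>\<alpha> \<in> Cell A; \<beta> \<in> Cell A; \<gamma> \<in> Cell A;
        Dom A (Src A \<beta>) = Cod A (Src A \<alpha>); Dom A (Src A \<gamma>) = Cod A (Src A \<beta>)\<rbrakk> \<Longrightarrow>
        \<gamma> \<star> (\<beta> \<star> \<alpha>) = \<gamma> \<star> \<beta> \<star> \<alpha>"
    and HComp_Id2: "\<lbrakk>f \<in> Mor A; g \<in> Mor A; Dom A g = Cod A f\<rbrakk> \<Longrightarrow>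
        Id2 A g \<star> Id2 A f = Id2 A (g \<odot> f)"
    and interchange: "\<lbrakk>\<alpha> \<in> Cell A; \<alpha>' \<in> Cell A; \<beta> \<in> Cell A; \<beta>' \<in> Cell A;
        Src A \<alpha>' = Tgt A \<alpha>; Src A \<beta>' = Tgt A \<beta>; Dom A (Src A \<beta>) = Cod A (Src A \<alpha>)\<rbrakk> \<Longrightarrow>
        (\<beta>' \<cdot> \<beta>) \<star> (\<alpha>' \<cdot> \<alpha>) = (\<beta>' \<star> \<alpha>') \<cdot> (\<beta> \<star> \<alpha>)"

definition hom_cat :: "('o, 'm, 'c) twocat \<Rightarrow> 'o \<Rightarrow> 'o \<Rightarrow> ('m, 'c) cat" where
  "hom_cat A X Y = \<lparr>
     Ob = {f \<in> Mor A. Dom A f = X \<and> Cod A f = Y},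
     Ar = {\<alpha> \<in> Cell A. Dom A (Src A \<alpha>) = X \<and> Cod A (Src A \<alpha>) = Y},
     dm = Src A, cd = Tgt A, ide = Id2 A, cmp = VComp A\<rparr>"

definition invertible_cell :: "('o, 'm, 'c) twocat \<Rightarrow> 'c \<Rightarrow> bool" where
  "invertible_cell A \<alpha> \<longleftrightarrow> \<alpha> \<in> Cell A \<and>
     (\<exists>\<beta>\<in>Cell A. Src A \<beta> = Tgt A \<alpha> \<and> Tgt A \<beta> = Src A \<alpha> \<and>
        \<beta> \<cdot>\<^bsub>A\<^esub> \<alpha> = Id2 A (Src A \<alpha>) \<and> \<alpha> \<cdot>\<^bsub>A\<^esub> \<beta> = Id2 A (Tgt A \<alpha>))"

definition two_terminal :: "('o, 'm, 'c) twocat \<Rightarrow> 'o \<Rightarrow> bool" where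
  "two_terminal B L \<longleftrightarrow> L \<in> Obj B \<and> (\<forall>X\<in>Obj B. isomorphic_cat (hom_cat B X L) terminal_cat)"

text \<open>A category, regarded as a 2-category with only identity 2-morphisms
  (the 2-morphism on \<open>f\<close> is \<open>f\<close> itself).\<close>

definition discrete_twocat :: "('o, 'm) cat \<Rightarrow> ('o, 'm, 'm) twocat" where
  "discrete_twocat C = \<lparr>Obj = Ob C, Mor = Ar C, Cell = Ar C, Dom = dm C, Cod = cd C,
     Src = (\<lambda>f. f), Tgt = (\<lambda>f. f), Id1 = ide C, Comp = cmp C, Id2 = (\<lambda>f. f),
     VComp = (\<lambda>g f. f), HComp = cmp C\<rparr>"


lemma two_category_discrete:
  assumes "category C" shows "two_category (discrete_twocat C)"
proof -
  interpret category C by fact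
  show ?thesis
    by unfold_locales (simp_all add: discrete_twocat_def dm_Ob cd_Ob ide_Ar cmp_Ar
        cmp_ide_left cmp_ide_right cmp_assoc)
qed


section \<open>2-functors, 2-natural transformations, modifications\<close>

record ('i, 'j, 'k, 'o, 'm, 'c) twofun =
  fun0 :: "'i \<Rightarrow> 'o"
  fun1 :: "'j \<Rightarrow> 'm"
  fun2 :: "'k \<Rightarrow> 'c"

locale two_functor =
  fixes I :: "('i, 'j, 'k) twocat" and A :: "('o, 'm, 'c) twocat"
    and F :: "('i, 'j, 'k, 'o, 'm, 'c) twofun"
  assumes fun0_Obj: "i \<in> Obj I \<Longrightarrow> fun0 F i \<in> Obj A"
    and fun1_Mor: "u \<in> Mor I \<Longrightarrow> fun1 F u \<in> Mor A \<and>
        Dom A (fun1 F u) = fun0 F (Dom I u) \<and> Cod A (fun1 F u) = fun0 F (Cod I u)"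
    and fun2_Cell: "\<theta> \<in> Cell I \<Longrightarrow> fun2 F \<theta> \<in> Cell A \<and>
        Src A (fun2 F \<theta>) = fun1 F (Src I \<theta>) \<and> Tgt A (fun2 F \<theta>) = fun1 F (Tgt I \<theta>)"
    and fun1_Id1: "i \<in> Obj I \<Longrightarrow> fun1 F (Id1 I i) = Id1 A (fun0 F i)"
    and fun1_Comp: "\<lbrakk>u \<in> Mor I; v \<in> Mor I; Dom I v = Cod I u\<rbrakk> \<Longrightarrow>
        fun1 F (v \<odot>\<^bsub>I\<^esub> u) = fun1 F v \<odot>\<^bsub>A\<^esub> fun1 F u"
    and fun2_Id2: "u \<in> Mor I \<Longrightarrow> fun2 F (Id2 I u) = Id2 A (fun1 F u)"
    and fun2_VComp: "\<lbrakk>\<theta> \<in> Cell I; \<eta> \<in> Cell I; Src I \<eta> = Tgt I \<theta>\<rbrakk> \<Longrightarrow>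
        fun2 F (\<eta> \<cdot>\<^bsub>I\<^esub> \<theta>) = fun2 F \<eta> \<cdot>\<^bsub>A\<^esub> fun2 F \<theta>"
    and fun2_HComp: "\<lbrakk>\<theta> \<in> Cell I; \<eta> \<in> Cell I; Dom I (Src I \<eta>) = Cod I (Src I \<theta>)\<rbrakk> \<Longrightarrow>
        fun2 F (\<eta> \<star>\<^bsub>I\<^esub> \<theta>) = fun2 F \<eta> \<star>\<^bsub>A\<^esub> fun2 F \<theta>"

record ('i, 'j, 'k, 'o, 'm, 'c) twonat =
  nat_src :: "('i, 'j, 'k, 'o, 'm, 'c) twofun"
  nat_tgt :: "('i, 'j, 'k, 'o, 'm, 'c) twofun"
  nat_at :: "'i \<Rightarrow> 'm"

record ('i, 'j, 'k, 'o, 'm, 'c) modif =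
  mod_src :: "('i, 'j, 'k, 'o, 'm, 'c) twonat"
  mod_tgt :: "('i, 'j, 'k, 'o, 'm, 'c) twonat"
  mod_at :: "'i \<Rightarrow> 'c"

locale two_natural =
  fixes I :: "('i, 'j, 'k) twocat" and A :: "('o, 'm, 'c) twocat"
    and \<mu> :: "('i, 'j, 'k, 'o, 'm, 'c) twonat"
  assumes nat_at_Mor: "i \<in> Obj I \<Longrightarrow> nat_at \<mu> i \<in> Mor A \<and>
        Dom A (nat_at \<mu> i) = fun0 (nat_src \<mu>) i \<and> Cod A (nat_at \<mu> i) = fun0 (nat_tgt \<mu>) i"
    and naturality1: "u \<in> Mor I \<Longrightarrow>
        fun1 (nat_tgt \<mu>) u \<odot>\<^bsub>A\<^esub> nat_at \<mu> (Dom I u) = nat_at \<mu> (Cod I u) \<odot>\<^bsub>A\<^esub> fun1 (nat_src \<mu>) u"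
    and naturality2: "\<theta> \<in> Cell I \<Longrightarrow>
        fun2 (nat_tgt \<mu>) \<theta> \<star>\<^bsub>A\<^esub> Id2 A (nat_at \<mu> (Dom I (Src I \<theta>))) =
        Id2 A (nat_at \<mu> (Cod I (Src I \<theta>))) \<star>\<^bsub>A\<^esub> fun2 (nat_src \<mu>) \<theta>"

locale modification =
  fixes I :: "('i, 'j, 'k) twocat" and A :: "('o, 'm, 'c) twocat"
    and \<phi> :: "('i, 'j, 'k, 'o, 'm, 'c) modif"
  assumes parallel_src: "nat_src (mod_src \<phi>) = nat_src (mod_tgt \<phi>)"
    and parallel_tgt: "nat_tgt (mod_src \<phi>) = nat_tgt (mod_tgt \<phi>)"
    and mod_at_Cell: "i \<in> Obj I \<Longrightarrow> mod_at \<phi> i \<in> Cell A \<and>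
        Src A (mod_at \<phi> i) = nat_at (mod_src \<phi>) i \<and> Tgt A (mod_at \<phi> i) = nat_at (mod_tgt \<phi>) i"
    and mod_naturality: "u \<in> Mor I \<Longrightarrow>
        Id2 A (fun1 (nat_tgt (mod_src \<phi>)) u) \<star>\<^bsub>A\<^esub> mod_at \<phi> (Dom I u) =
        mod_at \<phi> (Cod I u) \<star>\<^bsub>A\<^esub> Id2 A (fun1 (nat_src (mod_src \<phi>)) u)"

text \<open>The 2-category \<open>[I, A]\<close>. Families indexed by objects, morphisms and 2-morphisms of \<open>I\<close> are
  taken to be extensional, so that equality of records is equality of 2-functors, 2-natural
  transformations and modifications.\<close>

definition functor_twocat :: "('i, 'j, 'k) twocat \<Rightarrow> ('o, 'm, 'c) twocat \<Rightarrow>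
    (('i, 'j, 'k, 'o, 'm, 'c) twofun, ('i, 'j, 'k, 'o, 'm, 'c) twonat,
     ('i, 'j, 'k, 'o, 'm, 'c) modif) twocat" where
  "functor_twocat I A =
    (let Funs = {F. two_functor I A F \<and> fun0 F \<in> extensional (Obj I) \<and>
                    fun1 F \<in> extensional (Mor I) \<and> fun2 F \<in> extensional (Cell I)};
         Nats = {\<mu>. nat_src \<mu> \<in> Funs \<and> nat_tgt \<mu> \<in> Funs \<and> two_natural I A \<mu> \<and>
                    nat_at \<mu> \<in> extensional (Obj I)};
         Mods = {\<phi>. mod_src \<phi> \<in> Nats \<and> mod_tgt \<phi> \<in> Nats \<and> modification I A \<phi> \<and>
                    mod_at \<phi> \<in> extensional (Obj I)};
         nat_comp = (\<lambda>\<nu> \<mu>. \<lparr>nat_src = nat_src \<mu>, nat_tgt = nat_tgt \<nu>,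
                      nat_at = (\<lambda>i\<in>Obj I. nat_at \<nu> i \<odot>\<^bsub>A\<^esub> nat_at \<mu> i)\<rparr>)
     in \<lparr>Obj = Funs, Mor = Nats, Cell = Mods,
         Dom = nat_src, Cod = nat_tgt, Src = mod_src, Tgt = mod_tgt,
         Id1 = (\<lambda>F. \<lparr>nat_src = F, nat_tgt = F, nat_at = (\<lambda>i\<in>Obj I. Id1 A (fun0 F i))\<rparr>),
         Comp = nat_comp,
         Id2 = (\<lambda>\<mu>. \<lparr>mod_src = \<mu>, mod_tgt = \<mu>, mod_at = (\<lambda>i\<in>Obj I. Id2 A (nat_at \<mu> i))\<rparr>),
         VComp = (\<lambda>\<psi> \<phi>. \<lparr>mod_src = mod_src \<phi>, mod_tgt = mod_tgt \<psi>,
                    mod_at = (\<lambda>i\<in>Obj I. mod_at \<psi> i \<cdot>\<^bsub>A\<^esub> mod_at \<phi> i)\<rparr>),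
         HComp = (\<lambda>\<psi> \<phi>. \<lparr>mod_src = nat_comp (mod_src \<psi>) (mod_src \<phi>),
                    mod_tgt = nat_comp (mod_tgt \<psi>) (mod_tgt \<phi>),
                    mod_at = (\<lambda>i\<in>Obj I. mod_at \<psi> i \<star>\<^bsub>A\<^esub> mod_at \<phi> i)\<rparr>)\<rparr>)"

text \<open>The diagonal 2-functor \<open>\<Delta> : A \<rightarrow> [I, A]\<close> on objects, morphisms and 2-morphisms.\<close>

definition diag0 :: "('i, 'j, 'k) twocat \<Rightarrow> ('o, 'm, 'c) twocat \<Rightarrow> 'o \<Rightarrow>
    ('i, 'j, 'k, 'o, 'm, 'c) twofun" where
  "diag0 I A X = \<lparr>fun0 = (\<lambda>i\<in>Obj I. X), fun1 = (\<lambda>u\<in>Mor I. Id1 A X),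
     fun2 = (\<lambda>\<theta>\<in>Cell I. Id2 A (Id1 A X))\<rparr>"

definition diag1 :: "('i, 'j, 'k) twocat \<Rightarrow> ('o, 'm, 'c) twocat \<Rightarrow> 'm \<Rightarrow>
    ('i, 'j, 'k, 'o, 'm, 'c) twonat" where
  "diag1 I A f = \<lparr>nat_src = diag0 I A (Dom A f), nat_tgt = diag0 I A (Cod A f),
     nat_at = (\<lambda>i\<in>Obj I. f)\<rparr>"

definition diag2 :: "('i, 'j, 'k) twocat \<Rightarrow> ('o, 'm, 'c) twocat \<Rightarrow> 'c \<Rightarrow>
    ('i, 'j, 'k, 'o, 'm, 'c) modif" where
  "diag2 I A \<alpha> = \<lparr>mod_src = diag1 I A (Src A \<alpha>), mod_tgt = diag1 I A (Tgt A \<alpha>),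
     mod_at = (\<lambda>i\<in>Obj I. \<alpha>)\<rparr>"


section \<open>2-limits and the pseudo-slice of 2-cones\<close>

definition two_cones :: "('i, 'j, 'k) twocat \<Rightarrow> ('o, 'm, 'c) twocat \<Rightarrow>
    ('i, 'j, 'k, 'o, 'm, 'c) twofun \<Rightarrow> ('o \<times> ('i, 'j, 'k, 'o, 'm, 'c) twonat) set" where
  "two_cones I A F = {(X, \<mu>). X \<in> Obj A \<and> \<mu> \<in> Mor (functor_twocat I A) \<and>
     nat_src \<mu> = diag0 I A X \<and> nat_tgt \<mu> = F}"

definition is_two_limit :: "('i, 'j, 'k) twocat \<Rightarrow> ('o, 'm, 'c) twocat \<Rightarrow>
    ('i, 'j, 'k, 'o, 'm, 'c) twofun \<Rightarrow> 'o \<times> ('i, 'j, 'k, 'o, 'm, 'c) twonat \<Rightarrow> bool" where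
  "is_two_limit I A F = (\<lambda>(L, \<pi>). (L, \<pi>) \<in> two_cones I A F \<and>
     (\<forall>X\<in>Obj A. cat_iso (hom_cat A X L) (hom_cat (functor_twocat I A) (diag0 I A X) F)
        (\<lambda>f. \<pi> \<odot>\<^bsub>functor_twocat I A\<^esub> diag1 I A f)
        (\<lambda>\<alpha>. Id2 (functor_twocat I A) \<pi> \<star>\<^bsub>functor_twocat I A\<^esub> diag2 I A \<alpha>)))"

text \<open>In the pseudo-slice neither a pair \<open>(f, \<phi>)\<close> determines its codomain nor a 2-morphism \<open>\<alpha>\<close> its
  source and target, so morphisms and 2-morphisms carry their boundary: they are triples
  \<open>((X, \<mu>), (f, \<phi>), (Y, \<nu>))\<close> and \<open>(p, \<alpha>, q)\<close> with \<open>p\<close>, \<open>q\<close> parallel morphisms.\<close>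

type_synonym ('i, 'j, 'k, 'o, 'm, 'c) ps_obj = "'o \<times> ('i, 'j, 'k, 'o, 'm, 'c) twonat"
type_synonym ('i, 'j, 'k, 'o, 'm, 'c) ps_mor = "('i, 'j, 'k, 'o, 'm, 'c) ps_obj \<times>
  ('m \<times> ('i, 'j, 'k, 'o, 'm, 'c) modif) \<times> ('i, 'j, 'k, 'o, 'm, 'c) ps_obj"
type_synonym ('i, 'j, 'k, 'o, 'm, 'c) ps_cell =
  "('i, 'j, 'k, 'o, 'm, 'c) ps_mor \<times> 'c \<times> ('i, 'j, 'k, 'o, 'm, 'c) ps_mor"

definition ps_morphisms :: "('i, 'j, 'k) twocat \<Rightarrow> ('o, 'm, 'c) twocat \<Rightarrow>
    ('i, 'j, 'k, 'o, 'm, 'c) twofun \<Rightarrow> ('i, 'j, 'k, 'o, 'm, 'c) ps_mor set" where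
  "ps_morphisms I A F = {((X, \<mu>), (f, \<phi>), (Y, \<nu>)).
     (X, \<mu>) \<in> two_cones I A F \<and> (Y, \<nu>) \<in> two_cones I A F \<and>
     f \<in> Mor A \<and> Dom A f = X \<and> Cod A f = Y \<and>
     invertible_cell (functor_twocat I A) \<phi> \<and>
     mod_src \<phi> = \<nu> \<odot>\<^bsub>functor_twocat I A\<^esub> diag1 I A f \<and> mod_tgt \<phi> = \<mu>}"

definition ps_cells :: "('i, 'j, 'k) twocat \<Rightarrow> ('o, 'm, 'c) twocat \<Rightarrow>
    ('i, 'j, 'k, 'o, 'm, 'c) twofun \<Rightarrow> ('i, 'j, 'k, 'o, 'm, 'c) ps_cell set" where
  "ps_cells I A F = {((x, (f, \<phi>), (Y, \<nu>)), \<alpha>, (x', (g, \<psi>), y')).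
     (x, (f, \<phi>), (Y, \<nu>)) \<in> ps_morphisms I A F \<and> (x', (g, \<psi>), y') \<in> ps_morphisms I A F \<and>
     x' = x \<and> y' = (Y, \<nu>) \<and> \<alpha> \<in> Cell A \<and> Src A \<alpha> = f \<and> Tgt A \<alpha> = g \<and>
     \<psi> \<cdot>\<^bsub>functor_twocat I A\<^esub>
       (Id2 (functor_twocat I A) \<nu> \<star>\<^bsub>functor_twocat I A\<^esub> diag2 I A \<alpha>) = \<phi>}"

fun ps_comp :: "('i, 'j, 'k) twocat \<Rightarrow> ('o, 'm, 'c) twocat \<Rightarrow>
    ('i, 'j, 'k, 'o, 'm, 'c) ps_mor \<Rightarrow> ('i, 'j, 'k, 'o, 'm, 'c) ps_mor \<Rightarrow>
    ('i, 'j, 'k, 'o, 'm, 'c) ps_mor" where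
  "ps_comp I A (y, (g, \<psi>), z) (x, (f, \<phi>), y') = (x, (g \<odot>\<^bsub>A\<^esub> f,
     \<phi> \<cdot>\<^bsub>functor_twocat I A\<^esub>
       (\<psi> \<star>\<^bsub>functor_twocat I A\<^esub> Id2 (functor_twocat I A) (diag1 I A f))), z)"

definition pseudo_slice :: "('i, 'j, 'k) twocat \<Rightarrow> ('o, 'm, 'c) twocat \<Rightarrow>
    ('i, 'j, 'k, 'o, 'm, 'c) twofun \<Rightarrow> (('i, 'j, 'k, 'o, 'm, 'c) ps_obj,
      ('i, 'j, 'k, 'o, 'm, 'c) ps_mor, ('i, 'j, 'k, 'o, 'm, 'c) ps_cell) twocat" where
  "pseudo_slice I A F = \<lparr>
     Obj = two_cones I A F, Mor = ps_morphisms I A F, Cell = ps_cells I A F,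
     Dom = (\<lambda>(x, p, y). x), Cod = (\<lambda>(x, p, y). y),
     Src = (\<lambda>(p, \<alpha>, q). p), Tgt = (\<lambda>(p, \<alpha>, q). q),
     Id1 = (\<lambda>(X, \<mu>). ((X, \<mu>), (Id1 A X, Id2 (functor_twocat I A) \<mu>), (X, \<mu>))),
     Comp = ps_comp I A,
     Id2 = (\<lambda>(x, (f, \<phi>), y). ((x, (f, \<phi>), y), Id2 A f, (x, (f, \<phi>), y))),
     VComp = (\<lambda>(q, \<beta>, r) (p, \<alpha>, q'). (p, \<beta> \<cdot>\<^bsub>A\<^esub> \<alpha>, r)),
     HComp = (\<lambda>(p', \<beta>, q') (p, \<alpha>, q). (ps_comp I A p' p, \<beta> \<star>\<^bsub>A\<^esub> \<alpha>, ps_comp I A q' q))\<rparr>"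


section \<open>2-categories given by generators and relations\<close>

datatype ('o, 'e) mterm = MId 'o | MGen 'e | MComp "('o, 'e) mterm" "('o, 'e) mterm"

datatype ('o, 'e, 'c) cterm =
    CId "('o, 'e) mterm" | CGen 'c | CInv 'c
  | CV "('o, 'e, 'c) cterm" "('o, 'e, 'c) cterm"
  | CH "('o, 'e, 'c) cterm" "('o, 'e, 'c) cterm"

text \<open>A presentation: generating objects, morphisms and 2-morphisms, the set of generating
  2-morphisms declared invertible, and relations between morphisms. (Relations between
  2-morphisms are not provided for.)\<close>

record ('o, 'e, 'c) presentation =
  gobj :: "'o set"
  gmor :: "'e set"
  gdom :: "'e \<Rightarrow> 'o"
  gcod :: "'e \<Rightarrow> 'o"
  mrel :: "(('o, 'e) mterm \<times> ('o, 'e) mterm) set"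
  gcell :: "'c set"
  gsrc :: "'c \<Rightarrow> ('o, 'e) mterm"
  gtgt :: "'c \<Rightarrow> ('o, 'e) mterm"
  ginv :: "'c set"

fun mdom :: "('o, 'e, 'c) presentation \<Rightarrow> ('o, 'e) mterm \<Rightarrow> 'o" where
  "mdom P (MId x) = x"
| "mdom P (MGen e) = gdom P e"
| "mdom P (MComp t s) = mdom P s"

fun mcod :: "('o, 'e, 'c) presentation \<Rightarrow> ('o, 'e) mterm \<Rightarrow> 'o" where
  "mcod P (MId x) = x"
| "mcod P (MGen e) = gcod P e"
| "mcod P (MComp t s) = mcod P t"

fun mwf :: "('o, 'e, 'c) presentation \<Rightarrow> ('o, 'e) mterm \<Rightarrow> bool" where
  "mwf P (MId x) \<longleftrightarrow> x \<in> gobj P"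
| "mwf P (MGen e) \<longleftrightarrow> e \<in> gmor P"
| "mwf P (MComp t s) \<longleftrightarrow> mwf P t \<and> mwf P s \<and> mdom P t = mcod P s"

inductive meq :: "('o, 'e, 'c) presentation \<Rightarrow> ('o, 'e) mterm \<Rightarrow> ('o, 'e) mterm \<Rightarrow> bool" for P where
  meq_refl: "mwf P s \<Longrightarrow> meq P s s"
| meq_sym: "meq P s t \<Longrightarrow> meq P t s"
| meq_trans: "meq P s t \<Longrightarrow> meq P t u \<Longrightarrow> meq P s u"
| meq_rel: "(s, t) \<in> mrel P \<Longrightarrow> meq P s t"
| meq_comp: "meq P t t' \<Longrightarrow> meq P s s' \<Longrightarrow> mwf P (MComp t s) \<Longrightarrow> meq P (MComp t s) (MComp t' s')"
| meq_id_left: "mwf P s \<Longrightarrow> meq P (MComp (MId (mcod P s)) s) s"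
| meq_id_right: "mwf P s \<Longrightarrow> meq P (MComp s (MId (mdom P s))) s"
| meq_assoc: "mwf P (MComp u (MComp t s)) \<Longrightarrow> meq P (MComp u (MComp t s)) (MComp (MComp u t) s)"

fun csrc :: "('o, 'e, 'c) presentation \<Rightarrow> ('o, 'e, 'c) cterm \<Rightarrow> ('o, 'e) mterm" where
  "csrc P (CId s) = s"
| "csrc P (CGen c) = gsrc P c"
| "csrc P (CInv c) = gtgt P c"
| "csrc P (CV b a) = csrc P a"
| "csrc P (CH b a) = MComp (csrc P b) (csrc P a)"

fun ctgt :: "('o, 'e, 'c) presentation \<Rightarrow> ('o, 'e, 'c) cterm \<Rightarrow> ('o, 'e) mterm" where
  "ctgt P (CId s) = s"
| "ctgt P (CGen c) = gtgt P c"
| "ctgt P (CInv c) = gsrc P c"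
| "ctgt P (CV b a) = ctgt P b"
| "ctgt P (CH b a) = MComp (ctgt P b) (ctgt P a)"

fun cwf :: "('o, 'e, 'c) presentation \<Rightarrow> ('o, 'e, 'c) cterm \<Rightarrow> bool" where
  "cwf P (CId s) \<longleftrightarrow> mwf P s"
| "cwf P (CGen c) \<longleftrightarrow> c \<in> gcell P"
| "cwf P (CInv c) \<longleftrightarrow> c \<in> ginv P"
| "cwf P (CV b a) \<longleftrightarrow> cwf P b \<and> cwf P a \<and> meq P (csrc P b) (ctgt P a)"
| "cwf P (CH b a) \<longleftrightarrow> cwf P b \<and> cwf P a \<and> mdom P (csrc P b) = mcod P (csrc P a)"

inductive ceq :: "('o, 'e, 'c) presentation \<Rightarrow> ('o, 'e, 'c) cterm \<Rightarrow> ('o, 'e, 'c) cterm \<Rightarrow> bool"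
  for P where
  ceq_refl: "cwf P a \<Longrightarrow> ceq P a a"
| ceq_sym: "ceq P a b \<Longrightarrow> ceq P b a"
| ceq_trans: "ceq P a b \<Longrightarrow> ceq P b c \<Longrightarrow> ceq P a c"
| ceq_CId: "meq P s t \<Longrightarrow> ceq P (CId s) (CId t)"
| ceq_CV: "ceq P b b' \<Longrightarrow> ceq P a a' \<Longrightarrow> cwf P (CV b a) \<Longrightarrow> ceq P (CV b a) (CV b' a')"
| ceq_CH: "ceq P b b' \<Longrightarrow> ceq P a a' \<Longrightarrow> cwf P (CH b a) \<Longrightarrow> ceq P (CH b a) (CH b' a')"
| ceq_inv_left: "c \<in> ginv P \<Longrightarrow> ceq P (CV (CInv c) (CGen c)) (CId (gsrc P c))"
| ceq_inv_right: "c \<in> ginv P \<Longrightarrow> ceq P (CV (CGen c) (CInv c)) (CId (gtgt P c))"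
| ceq_V_id_left: "cwf P a \<Longrightarrow> ceq P (CV (CId (ctgt P a)) a) a"
| ceq_V_id_right: "cwf P a \<Longrightarrow> ceq P (CV a (CId (csrc P a))) a"
| ceq_V_assoc: "cwf P (CV c (CV b a)) \<Longrightarrow> ceq P (CV c (CV b a)) (CV (CV c b) a)"
| ceq_H_id_left: "cwf P a \<Longrightarrow> ceq P (CH (CId (MId (mcod P (csrc P a)))) a) a"
| ceq_H_id_right: "cwf P a \<Longrightarrow> ceq P (CH a (CId (MId (mdom P (csrc P a))))) a"
| ceq_H_assoc: "cwf P (CH c (CH b a)) \<Longrightarrow> ceq P (CH c (CH b a)) (CH (CH c b) a)"
| ceq_H_CId: "mwf P (MComp t s) \<Longrightarrow> ceq P (CH (CId t) (CId s)) (CId (MComp t s))"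
| ceq_interchange: "cwf P (CH (CV b' b) (CV a' a)) \<Longrightarrow>
    ceq P (CH (CV b' b) (CV a' a)) (CV (CH b' a') (CH b a))"

definition mcls :: "('o, 'e, 'c) presentation \<Rightarrow> ('o, 'e) mterm \<Rightarrow> ('o, 'e) mterm set" where
  "mcls P s = {t. meq P s t}"

definition ccls :: "('o, 'e, 'c) presentation \<Rightarrow> ('o, 'e, 'c) cterm \<Rightarrow> ('o, 'e, 'c) cterm set" where
  "ccls P a = {b. ceq P a b}"

definition rep :: "'t set \<Rightarrow> 't" where
  "rep p = (SOME t. t \<in> p)"

text \<open>The operations are computed on representatives; they do not depend on the choice
  (lemmas \<open>presented_simps\<close> below).\<close>

definition presented_twocat :: "('o, 'e, 'c) presentation \<Rightarrow>
    ('o, ('o, 'e) mterm set, ('o, 'e, 'c) cterm set) twocat" where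
  "presented_twocat P = \<lparr>
     Obj = gobj P, Mor = mcls P ` {s. mwf P s}, Cell = ccls P ` {a. cwf P a},
     Dom = (\<lambda>p. mdom P (rep p)), Cod = (\<lambda>p. mcod P (rep p)),
     Src = (\<lambda>p. mcls P (csrc P (rep p))), Tgt = (\<lambda>p. mcls P (ctgt P (rep p))),
     Id1 = (\<lambda>x. mcls P (MId x)),
     Comp = (\<lambda>q p. mcls P (MComp (rep q) (rep p))),
     Id2 = (\<lambda>p. ccls P (CId (rep p))),
     VComp = (\<lambda>q p. ccls P (CV (rep q) (rep p))),
     HComp = (\<lambda>q p. ccls P (CH (rep q) (rep p)))\<rparr>"

locale wf_presentation =
  fixes P :: "('o, 'e, 'c) presentation"
  assumes gdom_gobj: "e \<in> gmor P \<Longrightarrow> gdom P e \<in> gobj P"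
    and gcod_gobj: "e \<in> gmor P \<Longrightarrow> gcod P e \<in> gobj P"
    and mrel_wf: "(s, t) \<in> mrel P \<Longrightarrow>
        mwf P s \<and> mwf P t \<and> mdom P s = mdom P t \<and> mcod P s = mcod P t"
    and ginv_gcell: "c \<in> ginv P \<Longrightarrow> c \<in> gcell P"
    and gcell_wf: "c \<in> gcell P \<Longrightarrow> mwf P (gsrc P c) \<and> mwf P (gtgt P c) \<and>
        mdom P (gsrc P c) = mdom P (gtgt P c) \<and> mcod P (gsrc P c) = mcod P (gtgt P c)"
begin

lemma mwf_bd: "mwf P s \<Longrightarrow> mdom P s \<in> gobj P \<and> mcod P s \<in> gobj P"
  by (induction s) (auto simp: gdom_gobj gcod_gobj)

lemma meq_wf: "meq P s t \<Longrightarrow> mwf P s \<and> mwf P t \<and> mdom P s = mdom P t \<and> mcod P s = mcod P t"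
  by (induction rule: meq.induct) (auto dest: mrel_wf mwf_bd)

lemma cwf_bd: "cwf P a \<Longrightarrow> mwf P (csrc P a) \<and> mwf P (ctgt P a) \<and>
    mdom P (csrc P a) = mdom P (ctgt P a) \<and> mcod P (csrc P a) = mcod P (ctgt P a)"
  by (induction a) (use ginv_gcell gcell_wf meq_wf in \<open>fastforce+\<close>)

lemma ceq_wf: "ceq P a b \<Longrightarrow> cwf P a \<and> cwf P b \<and> meq P (csrc P a) (csrc P b) \<and> meq P (ctgt P a) (ctgt P b)"
proof (induction rule: ceq.induct)
  case (ceq_CV b b' a a')
  then have "meq P (csrc P b') (ctgt P a')"
    by (metis cwf.simps(4) meq_sym meq_trans)
  with ceq_CV show ?case by simp
next
  case (ceq_CH b b' a a')
  then have "mwf P (csrc P b)" "mwf P (csrc P a)" "mwf P (ctgt P b)" "mwf P (ctgt P a)"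
    "mdom P (csrc P b) = mcod P (csrc P a)" "mdom P (ctgt P b) = mcod P (ctgt P a)"
    using cwf_bd[of a] cwf_bd[of b] by auto
  moreover from this ceq_CH.IH have "mdom P (csrc P b') = mcod P (csrc P a')"
    using meq_wf by metis
  ultimately show ?case using ceq_CH by (simp add: meq_comp)
next
  case (ceq_interchange b' b a' a)
  then have *: "cwf P a" "cwf P b" "cwf P a'" "cwf P b'"
    "meq P (csrc P b') (ctgt P b)" "meq P (csrc P a') (ctgt P a)"
    "mdom P (csrc P b) = mcod P (csrc P a)" by auto
  note bd = *(1-4)[THEN cwf_bd]
  have "mdom P (csrc P b') = mcod P (csrc P a')" using *(5,6)[THEN meq_wf] *(7) bd by simp
  with * bd show ?case by (auto intro!: meq_comp meq_refl)
next
  case (ceq_H_id_left a)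
  then show ?case using cwf_bd[of a] mwf_bd[of "csrc P a"] meq_id_left[of P "csrc P a"]
      meq_id_left[of P "ctgt P a"] by simp
next
  case (ceq_H_id_right a)
  then show ?case using cwf_bd[of a] mwf_bd[of "csrc P a"] meq_id_right[of P "csrc P a"]
      meq_id_right[of P "ctgt P a"] by simp
next
  case (ceq_H_assoc c b a)
  then show ?case using cwf_bd[of a] cwf_bd[of b] cwf_bd[of c]
    by (simp add: meq_assoc)
next
  case (ceq_inv_left c)
  then show ?case using ginv_gcell gcell_wf by (simp add: meq_refl)
next
  case (ceq_inv_right c)
  then show ?case using ginv_gcell gcell_wf by (simp add: meq_refl)
next
  case (ceq_CId s t)
  then show ?case using meq_wf by simp
next
  case (ceq_H_CId t s)
  then show ?case by (simp add: meq_refl)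
next
  case (ceq_sym a b)
  then show ?case by (simp add: meq_sym)
next
  case (ceq_trans a b c)
  then show ?case by (metis meq_trans)
qed (auto dest: cwf_bd intro: meq_refl)

lemma mcls_eq: "mwf P s \<Longrightarrow> mcls P s = mcls P t \<longleftrightarrow> meq P s t"
  unfolding mcls_def by (auto intro: meq.intros)

lemma ccls_eq: "cwf P a \<Longrightarrow> ccls P a = ccls P b \<longleftrightarrow> ceq P a b"
  unfolding ccls_def by (auto intro: ceq.intros)

lemma rep_mcls: "mwf P s \<Longrightarrow> meq P s (rep (mcls P s))"
  unfolding rep_def mcls_def by (metis mem_Collect_eq meq_refl someI)

lemma rep_ccls: "cwf P a \<Longrightarrow> ceq P a (rep (ccls P a))"
  unfolding rep_def ccls_def by (metis mem_Collect_eq ceq_refl someI)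

lemma presented_simps:
  "Obj (presented_twocat P) = gobj P"
  "mwf P s \<Longrightarrow> mcls P s \<in> Mor (presented_twocat P)"
  "cwf P a \<Longrightarrow> ccls P a \<in> Cell (presented_twocat P)"
  "mwf P s \<Longrightarrow> Dom (presented_twocat P) (mcls P s) = mdom P s"
  "mwf P s \<Longrightarrow> Cod (presented_twocat P) (mcls P s) = mcod P s"
  "cwf P a \<Longrightarrow> Src (presented_twocat P) (ccls P a) = mcls P (csrc P a)"
  "cwf P a \<Longrightarrow> Tgt (presented_twocat P) (ccls P a) = mcls P (ctgt P a)"
  "Id1 (presented_twocat P) x = mcls P (MId x)"
  "mwf P (MComp t s) \<Longrightarrow> mcls P t \<odot>\<^bsub>presented_twocat P\<^esub> mcls P s = mcls P (MComp t s)"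
  "mwf P s \<Longrightarrow> Id2 (presented_twocat P) (mcls P s) = ccls P (CId s)"
  "cwf P (CV b a) \<Longrightarrow> ccls P b \<cdot>\<^bsub>presented_twocat P\<^esub> ccls P a = ccls P (CV b a)"
  "cwf P (CH b a) \<Longrightarrow> ccls P b \<star>\<^bsub>presented_twocat P\<^esub> ccls P a = ccls P (CH b a)"
proof -
  show "mwf P s \<Longrightarrow> Dom (presented_twocat P) (mcls P s) = mdom P s"
    "mwf P s \<Longrightarrow> Cod (presented_twocat P) (mcls P s) = mcod P s"
    using rep_mcls meq_wf by (fastforce simp: presented_twocat_def)+
  show "cwf P a \<Longrightarrow> Src (presented_twocat P) (ccls P a) = mcls P (csrc P a)"
    "cwf P a \<Longrightarrow> Tgt (presented_twocat P) (ccls P a) = mcls P (ctgt P a)"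
    using rep_ccls ceq_wf cwf_bd mcls_eq by (fastforce simp: presented_twocat_def)+
  show "mwf P (MComp t s) \<Longrightarrow> mcls P t \<odot>\<^bsub>presented_twocat P\<^esub> mcls P s = mcls P (MComp t s)"
    by (simp add: presented_twocat_def) (metis rep_mcls mcls_eq meq_comp mwf.simps(3))
  show "mwf P s \<Longrightarrow> Id2 (presented_twocat P) (mcls P s) = ccls P (CId s)"
    by (simp add: presented_twocat_def) (metis rep_mcls ccls_eq ceq_CId cwf.simps(1))
  show "cwf P (CV b a) \<Longrightarrow> ccls P b \<cdot>\<^bsub>presented_twocat P\<^esub> ccls P a = ccls P (CV b a)"
    by (simp add: presented_twocat_def) (metis rep_ccls ccls_eq ceq_CV cwf.simps(4))
  show "cwf P (CH b a) \<Longrightarrow> ccls P b \<star>\<^bsub>presented_twocat P\<^esub> ccls P a = ccls P (CH b a)"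
    by (simp add: presented_twocat_def) (metis rep_ccls ccls_eq ceq_CH cwf.simps(5))
qed (auto simp: presented_twocat_def)

lemma Mor_E: "p \<in> Mor (presented_twocat P) \<Longrightarrow> (\<And>s. mwf P s \<Longrightarrow> p = mcls P s \<Longrightarrow> thesis) \<Longrightarrow> thesis"
  by (auto simp: presented_twocat_def)

lemma Cell_E: "p \<in> Cell (presented_twocat P) \<Longrightarrow> (\<And>a. cwf P a \<Longrightarrow> p = ccls P a \<Longrightarrow> thesis) \<Longrightarrow> thesis"
  by (auto simp: presented_twocat_def)



theorem presented_two_category: "two_category (presented_twocat P)"
proof
  let ?A = "presented_twocat P"
  note simps = presented_simps
  fix f g h assume f: "f \<in> Mor ?A"
  then obtain s where s: "mwf P s" "f = mcls P s" by (rule Mor_E)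
  note sb = mwf_bd[OF s(1)]
  show "Dom ?A f \<in> Obj ?A" "Cod ?A f \<in> Obj ?A" using s sb by (simp_all add: simps)
  show "Comp ?A (Id1 ?A (Cod ?A f)) f = f" "Comp ?A f (Id1 ?A (Dom ?A f)) = f"
    using s sb by (simp_all add: simps mcls_eq meq_id_left meq_id_right)
  show "Id2 ?A f \<in> Cell ?A \<and> Src ?A (Id2 ?A f) = f \<and> Tgt ?A (Id2 ?A f) = f"
    using s by (simp add: simps)
  assume g: "g \<in> Mor ?A" "Dom ?A g = Cod ?A f"
  then obtain t where t: "mwf P t" "g = mcls P t" by (blast elim: Mor_E)
  have gf: "mdom P t = mcod P s" using g s t by (simp add: simps)
  show "Comp ?A g f \<in> Mor ?A \<and> Dom ?A (Comp ?A g f) = Dom ?A f \<and> Cod ?A (Comp ?A g f) = Cod ?A g"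
    "HComp ?A (Id2 ?A g) (Id2 ?A f) = Id2 ?A (Comp ?A g f)"
    using s t gf by (simp_all add: simps ccls_eq ceq_H_CId)
  assume h: "h \<in> Mor ?A" "Dom ?A h = Cod ?A g"
  then obtain u where u: "mwf P u" "h = mcls P u" by (blast elim: Mor_E)
  have "mdom P u = mcod P t" using h t u by (simp add: simps)
  then show "Comp ?A h (Comp ?A g f) = Comp ?A (Comp ?A h g) f"
    using s t u gf by (simp add: simps mcls_eq meq_assoc)
next
  let ?A = "presented_twocat P"
  fix x assume "x \<in> Obj ?A"
  then show "Id1 ?A x \<in> Mor ?A \<and> Dom ?A (Id1 ?A x) = x \<and> Cod ?A (Id1 ?A x) = x"
    by (simp add: presented_simps)
next
  let ?A = "presented_twocat P"
  note simps = presented_simps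
  fix \<alpha> assume "\<alpha> \<in> Cell ?A"
  then obtain a where a: "cwf P a" "\<alpha> = ccls P a" by (rule Cell_E)
  note ab = cwf_bd[OF a(1)]
  note ac = ab[THEN conjunct1, THEN mwf_bd]
  show "Src ?A \<alpha> \<in> Mor ?A \<and> Tgt ?A \<alpha> \<in> Mor ?A \<and> Dom ?A (Src ?A \<alpha>) = Dom ?A (Tgt ?A \<alpha>) \<and>
    Cod ?A (Src ?A \<alpha>) = Cod ?A (Tgt ?A \<alpha>)"
    using a ab by (simp add: simps)
  show "VComp ?A (Id2 ?A (Tgt ?A \<alpha>)) \<alpha> = \<alpha>" "VComp ?A \<alpha> (Id2 ?A (Src ?A \<alpha>)) = \<alpha>"
    "HComp ?A (Id2 ?A (Id1 ?A (Cod ?A (Src ?A \<alpha>)))) \<alpha> = \<alpha>"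
    "HComp ?A \<alpha> (Id2 ?A (Id1 ?A (Dom ?A (Src ?A \<alpha>)))) = \<alpha>"
    using a ab ac ceq_H_id_left[OF a(1)] ceq_H_id_right[OF a(1)]
    by (simp_all add: simps meq_refl ccls_eq ceq_V_id_left ceq_V_id_right)
next
  let ?A = "presented_twocat P"
  note simps = presented_simps
  fix \<alpha> \<beta> \<gamma> assume "\<alpha> \<in> Cell ?A" "\<beta> \<in> Cell ?A" and ba: "Src ?A \<beta> = Tgt ?A \<alpha>"
  then obtain a b where a: "cwf P a" "\<alpha> = ccls P a" and b: "cwf P b" "\<beta> = ccls P b"
    by (blast elim: Cell_E)
  note bd = cwf_bd[OF a(1)] cwf_bd[OF b(1)]
  have m: "meq P (csrc P b) (ctgt P a)" using a b ba bd by (simp add: simps mcls_eq)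
  show "VComp ?A \<beta> \<alpha> \<in> Cell ?A \<and> Src ?A (VComp ?A \<beta> \<alpha>) = Src ?A \<alpha> \<and> Tgt ?A (VComp ?A \<beta> \<alpha>) = Tgt ?A \<beta>"
    using a b m by (simp add: simps)
  assume "\<gamma> \<in> Cell ?A" and cb: "Src ?A \<gamma> = Tgt ?A \<beta>"
  then obtain c where c: "cwf P c" "\<gamma> = ccls P c" by (blast elim: Cell_E)
  have "meq P (csrc P c) (ctgt P b)" using c b cb bd cwf_bd[OF c(1)] by (simp add: simps mcls_eq)
  then show "VComp ?A \<gamma> (VComp ?A \<beta> \<alpha>) = VComp ?A (VComp ?A \<gamma> \<beta>) \<alpha>"
    using a b c m by (simp add: simps ccls_eq ceq_V_assoc)
next
  let ?A = "presented_twocat P"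
  note simps = presented_simps
  fix \<alpha> \<beta> \<gamma> assume "\<alpha> \<in> Cell ?A" "\<beta> \<in> Cell ?A" and ba: "Dom ?A (Src ?A \<beta>) = Cod ?A (Src ?A \<alpha>)"
  then obtain a b where a: "cwf P a" "\<alpha> = ccls P a" and b: "cwf P b" "\<beta> = ccls P b"
    by (blast elim: Cell_E)
  note bd = cwf_bd[OF a(1)] cwf_bd[OF b(1)]
  have m: "mdom P (csrc P b) = mcod P (csrc P a)" using a b ba bd by (simp add: simps)
  show "HComp ?A \<beta> \<alpha> \<in> Cell ?A \<and> Src ?A (HComp ?A \<beta> \<alpha>) = Comp ?A (Src ?A \<beta>) (Src ?A \<alpha>) \<and>
      Tgt ?A (HComp ?A \<beta> \<alpha>) = Comp ?A (Tgt ?A \<beta>) (Tgt ?A \<alpha>)"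
    using a b m bd by (simp add: simps)
  assume "\<gamma> \<in> Cell ?A" and cb: "Dom ?A (Src ?A \<gamma>) = Cod ?A (Src ?A \<beta>)"
  then obtain c where c: "cwf P c" "\<gamma> = ccls P c" by (blast elim: Cell_E)
  have "mdom P (csrc P c) = mcod P (csrc P b)" using c b cb bd cwf_bd[OF c(1)] by (simp add: simps)
  then show "HComp ?A \<gamma> (HComp ?A \<beta> \<alpha>) = HComp ?A (HComp ?A \<gamma> \<beta>) \<alpha>"
    using a b c m by (simp add: simps ccls_eq ceq_H_assoc)
next
  let ?A = "presented_twocat P"
  note simps = presented_simps
  fix \<alpha> \<alpha>' \<beta> \<beta>'
  assume cells: "\<alpha> \<in> Cell ?A" "\<alpha>' \<in> Cell ?A" "\<beta> \<in> Cell ?A" "\<beta>' \<in> Cell ?A"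
    and as: "Src ?A \<alpha>' = Tgt ?A \<alpha>" "Src ?A \<beta>' = Tgt ?A \<beta>" "Dom ?A (Src ?A \<beta>) = Cod ?A (Src ?A \<alpha>)"
  obtain a where a: "cwf P a" "\<alpha> = ccls P a" by (rule Cell_E[OF cells(1)])
  obtain a' where a': "cwf P a'" "\<alpha>' = ccls P a'" by (rule Cell_E[OF cells(2)])
  obtain b where b: "cwf P b" "\<beta> = ccls P b" by (rule Cell_E[OF cells(3)])
  obtain b' where b': "cwf P b'" "\<beta>' = ccls P b'" by (rule Cell_E[OF cells(4)])
  note bd = cwf_bd[OF a(1)] cwf_bd[OF b(1)] cwf_bd[OF a'(1)] cwf_bd[OF b'(1)]
  have m: "meq P (csrc P a') (ctgt P a)" "meq P (csrc P b') (ctgt P b)"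
    "mdom P (csrc P b) = mcod P (csrc P a)"
    using a b a' b' as bd by (simp_all add: simps mcls_eq)
  have w: "cwf P (CH (CV b' b) (CV a' a))" using a b a' b' m by simp
  have w': "cwf P (CV (CH b' a') (CH b a))" using ceq_wf[OF ceq_interchange[OF w]] by blast
  show "HComp ?A (VComp ?A \<beta>' \<beta>) (VComp ?A \<alpha>' \<alpha>) = VComp ?A (HComp ?A \<beta>' \<alpha>') (HComp ?A \<beta> \<alpha>)"
    using a b a' b' w w' ccls_eq[OF w] ceq_interchange[OF w] by (simp add: simps)
qed

end


section \<open>The pullback shape and the presented 2-category\<close>

text \<open>The shape \<open>SB \<rightarrow> SA \<leftarrow> SC\<close>.\<close>

datatype shape_ob = SB | SA | SC
datatype shape_ar = SId shape_ob | Sb | Sc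

fun shape_dm :: "shape_ar \<Rightarrow> shape_ob" where
  "shape_dm (SId i) = i" | "shape_dm Sb = SB" | "shape_dm Sc = SC"

fun shape_cd :: "shape_ar \<Rightarrow> shape_ob" where
  "shape_cd (SId i) = i" | "shape_cd Sb = SA" | "shape_cd Sc = SA"

text \<open>Composable pairs always contain an identity; other pairs get a junk value.\<close>

fun shape_cmp :: "shape_ar \<Rightarrow> shape_ar \<Rightarrow> shape_ar" where
  "shape_cmp (SId i) u = u"
| "shape_cmp v u = v"

definition pullback_shape :: "(shape_ob, shape_ar) cat" where
  "pullback_shape = \<lparr>Ob = UNIV, Ar = UNIV, dm = shape_dm, cd = shape_cd, ide = SId, cmp = shape_cmp\<rparr>"

lemma category_pullback_shape: "category pullback_shape"
proof (unfold_locales, simp_all add: pullback_shape_def)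
  fix f g h
  show "shape_cmp f (SId (shape_dm f)) = f"
    by (cases f; simp)
  assume "shape_dm g = shape_cd f"
  then show "shape_dm (shape_cmp g f) = shape_dm f \<and> shape_cd (shape_cmp g f) = shape_cd g"
    by (cases g; cases f; simp)
  show "shape_cmp h (shape_cmp g f) = shape_cmp (shape_cmp h g) f"
    by (cases h; cases g; simp)
qed

definition shape :: "(shape_ob, shape_ar, shape_ar) twocat" where
  "shape = discrete_twocat pullback_shape"

lemma two_category_shape: "two_category shape"
  unfolding shape_def by (rule two_category_discrete[OF category_pullback_shape])

datatype gen_ob = OX | OL | OA | OB | OC
datatype gen_ar = Gf | Gg | Glam0 | Glam1 | Gb | Gc
datatype gen_cell = Galpha

fun gen_dom :: "gen_ar \<Rightarrow> gen_ob" where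
  "gen_dom Gf = OX" | "gen_dom Gg = OX" | "gen_dom Glam0 = OL" | "gen_dom Glam1 = OL"
| "gen_dom Gb = OB" | "gen_dom Gc = OC"

fun gen_cod :: "gen_ar \<Rightarrow> gen_ob" where
  "gen_cod Gf = OL" | "gen_cod Gg = OL" | "gen_cod Glam0 = OB" | "gen_cod Glam1 = OC"
| "gen_cod Gb = OA" | "gen_cod Gc = OA"

definition exP :: "(gen_ob, gen_ar, gen_cell) presentation" where
  "exP = \<lparr>gobj = UNIV, gmor = UNIV, gdom = gen_dom, gcod = gen_cod,
     mrel = {(MComp (MGen Gb) (MGen Glam0), MComp (MGen Gc) (MGen Glam1))},
     gcell = UNIV, gsrc = (\<lambda>_. MGen Gf), gtgt = (\<lambda>_. MGen Gg), ginv = UNIV\<rparr>"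

lemma wf_exP: "wf_presentation exP"
  by unfold_locales (auto simp: exP_def)

type_synonym ex_mor = "(gen_ob, gen_ar) mterm set"
type_synonym ex_cell = "(gen_ob, gen_ar, gen_cell) cterm set"

definition exA :: "(gen_ob, ex_mor, ex_cell) twocat" where
  "exA = presented_twocat exP"

lemma two_category_exA: "two_category exA"
  unfolding exA_def by (rule wf_presentation.presented_two_category[OF wf_exP])

definition ex_gen :: "gen_ar \<Rightarrow> ex_mor" where
  "ex_gen e = mcls exP (MGen e)"

lemma ex_gen_Mor:
  "ex_gen e \<in> Mor exA \<and> Dom exA (ex_gen e) = gen_dom e \<and> Cod exA (ex_gen e) = gen_cod e"
  using wf_presentation.presented_simps(2,4,5)[OF wf_exP, of "MGen e"]
  by (simp add: exA_def ex_gen_def exP_def)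

lemma Obj_exA: "Obj exA = UNIV"
  by (simp add: exA_def presented_twocat_def exP_def)

lemma ex_relation: "ex_gen Gb \<odot>\<^bsub>exA\<^esub> ex_gen Glam0 = ex_gen Gc \<odot>\<^bsub>exA\<^esub> ex_gen Glam1"
proof -
  have "mwf exP (MComp (MGen Gb) (MGen Glam0))" "mwf exP (MComp (MGen Gc) (MGen Glam1))"
    by (simp_all add: exP_def)
  moreover have "meq exP (MComp (MGen Gb) (MGen Glam0)) (MComp (MGen Gc) (MGen Glam1))"
    by (rule meq_rel) (simp add: exP_def)
  ultimately show ?thesis
    using wf_presentation.presented_simps(9)[OF wf_exP] wf_presentation.mcls_eq[OF wf_exP]
    by (simp add: exA_def ex_gen_def)
qed

fun exF0 :: "shape_ob \<Rightarrow> gen_ob" where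
  "exF0 SB = OB" | "exF0 SA = OA" | "exF0 SC = OC"

fun exF1 :: "shape_ar \<Rightarrow> ex_mor" where
  "exF1 (SId i) = Id1 exA (exF0 i)" | "exF1 Sb = ex_gen Gb" | "exF1 Sc = ex_gen Gc"

definition exF :: "(shape_ob, shape_ar, shape_ar, gen_ob, ex_mor, ex_cell) twofun" where
  "exF = \<lparr>fun0 = exF0, fun1 = exF1, fun2 = (\<lambda>u. Id2 exA (exF1 u))\<rparr>"

lemma two_functor_exF: "two_functor shape exA exF"
proof -
  interpret A: two_category exA by (rule two_category_exA)
  have 1: "exF1 u \<in> Mor exA \<and> Dom exA (exF1 u) = exF0 (shape_dm u) \<and> Cod exA (exF1 u) = exF0 (shape_cd u)" for u
    using A.Id1_Mor by (cases u) (auto simp: ex_gen_Mor Obj_exA)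
  have 2: "exF1 (shape_cmp v u) = exF1 v \<odot>\<^bsub>exA\<^esub> exF1 u" if "shape_dm v = shape_cd u" for u v
    using that A.Comp_Id1_left[of "exF1 u"] A.Comp_Id1_right[of "exF1 v"] 1[of u] 1[of v]
    by (cases v; cases u) auto
  show ?thesis
  proof
    fix u v assume "u \<in> Cell shape" "v \<in> Cell shape" "Src shape v = Tgt shape u"
    then show "fun2 exF (v \<cdot>\<^bsub>shape\<^esub> u) = fun2 exF v \<cdot>\<^bsub>exA\<^esub> fun2 exF u"
      using A.VComp_Id2_left[of "Id2 exA (exF1 u)"] A.Id2_Cell[of "exF1 u"] 1[of u]
      by (simp add: exF_def shape_def discrete_twocat_def)
  next
    fix u v assume "u \<in> Cell shape" "v \<in> Cell shape" "Dom shape (Src shape v) = Cod shape (Src shape u)"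
    then show "fun2 exF (v \<star>\<^bsub>shape\<^esub> u) = fun2 exF v \<star>\<^bsub>exA\<^esub> fun2 exF u"
      using A.HComp_Id2[of "exF1 u" "exF1 v"] 1[of u] 1[of v] 2[of v u]
      by (simp add: exF_def shape_def discrete_twocat_def pullback_shape_def)
  qed (use 1 2 A.Id2_Cell in \<open>simp_all add: exF_def shape_def discrete_twocat_def pullback_shape_def Obj_exA\<close>)
qed

fun ex_cone_at :: "shape_ob \<Rightarrow> ex_mor" where
  "ex_cone_at SB = ex_gen Glam0"
| "ex_cone_at SC = ex_gen Glam1"
| "ex_cone_at SA = ex_gen Gb \<odot>\<^bsub>exA\<^esub> ex_gen Glam0"

definition ex_cone :: "(shape_ob, shape_ar, shape_ar, gen_ob, ex_mor, ex_cell) twonat" where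
  "ex_cone = \<lparr>nat_src = diag0 shape exA OL, nat_tgt = exF, nat_at = ex_cone_at\<rparr>"

end

theory Submission
  imports Defs
begin

text \<open>The inverse of \<open>\<alpha>\<close> replaces \<open>g\<close> by \<open>f\<close> in every morphism, naturally and invertibly. Hence in the
  presented 2-category any two parallel morphisms are joined by a unique 2-morphism, and the
  2-category \<open>[I, A]\<close> inherits this property.
  So the 2-limit property reduces to a bijection between morphisms \<open>X \<rightarrow> L\<close> and 2-cones on \<open>X\<close>.
  This holds because a morphism is determined by its domain, its codomain and whether it involves
  \<open>g\<close>, and the relation \<open>b \<lambda>\<^sub>0 = c \<lambda>\<^sub>1\<close> forces the two legs of a cone to agree on the latter. On the
  other hand, in the pseudo-slice both \<open>f\<close> and \<open>g\<close> underlie morphisms from the cone \<open>\<lambda> f\<close> to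
  \<open>\<lambda>\<close>, the second via the whiskered inverse of \<open>\<alpha>\<close>.\<close>

section \<open>Indiscrete categories\<close>

text \<open>Unit and associativity laws are left out because each equates two arrows with the same
  ends, so \<open>ex1_Ar\<close> already implies them. Only the typing of the operations is left to
  check for a concrete category.\<close>

locale indiscrete_cat =
  fixes C :: "('o, 'm) cat"
  assumes dm_Ob: "f \<in> Ar C \<Longrightarrow> dm C f \<in> Ob C"
    and cd_Ob: "f \<in> Ar C \<Longrightarrow> cd C f \<in> Ob C"
    and ide_Ar: "x \<in> Ob C \<Longrightarrow> ide C x \<in> Ar C \<and> dm C (ide C x) = x \<and> cd C (ide C x) = x"
    and cmp_Ar: "\<lbrakk>f \<in> Ar C; g \<in> Ar C; dm C g = cd C f\<rbrakk> \<Longrightarrow>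
        cmp C g f \<in> Ar C \<and> dm C (cmp C g f) = dm C f \<and> cd C (cmp C g f) = cd C g"
    and ex1_Ar: "\<lbrakk>x \<in> Ob C; y \<in> Ob C\<rbrakk> \<Longrightarrow> \<exists>!f. f \<in> Ar C \<and> dm C f = x \<and> cd C f = y"
begin

lemma Ar_eqI: "\<lbrakk>f \<in> Ar C; g \<in> Ar C; dm C f = dm C g; cd C f = cd C g\<rbrakk> \<Longrightarrow> f = g"
  using ex1_Ar dm_Ob cd_Ob by metis

end

lemma cat_functor_indiscrete:
  assumes "indiscrete_cat C" "indiscrete_cat D"
    and F0: "\<And>x. x \<in> Ob C \<Longrightarrow> F0 x \<in> Ob D"
    and F1: "\<And>f. f \<in> Ar C \<Longrightarrow> F1 f \<in> Ar D \<and> dm D (F1 f) = F0 (dm C f) \<and> cd D (F1 f) = F0 (cd C f)"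
  shows "cat_functor C D F0 F1"
proof -
  interpret C: indiscrete_cat C by fact
  interpret D: indiscrete_cat D by fact
  show ?thesis
  proof
    fix x assume "x \<in> Ob C"
    then show "F1 (ide C x) = ide D (F0 x)"
      using F0 F1 C.ide_Ar D.ide_Ar by (intro D.Ar_eqI) auto
  next
    fix f g assume "f \<in> Ar C" "g \<in> Ar C" "dm C g = cd C f"
    then show "F1 (cmp C g f) = cmp D (F1 g) (F1 f)"
      using F1 C.cmp_Ar[of f g] D.cmp_Ar[of "F1 f" "F1 g"] by (intro D.Ar_eqI) auto
  qed (use F0 F1 in auto)
qed

text \<open>The inverse functor sends an arrow to the unique arrow between the preimages of its
  ends. Functoriality both ways and the round trips on arrows compare arrows with equal ends, so
  bijectivity on objects is the only real condition.\<close>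

lemma cat_iso_indiscrete:
  assumes C: "indiscrete_cat C" and D: "indiscrete_cat D"
    and bij: "bij_betw F0 (Ob C) (Ob D)"
    and F1: "\<And>f. f \<in> Ar C \<Longrightarrow> F1 f \<in> Ar D \<and> dm D (F1 f) = F0 (dm C f) \<and> cd D (F1 f) = F0 (cd C f)"
  shows "cat_iso C D F0 F1"
proof -
  interpret C: indiscrete_cat C by fact
  interpret D: indiscrete_cat D by fact
  define G0 where "G0 = inv_into (Ob C) F0"
  define G1 where "G1 g = (THE f. f \<in> Ar C \<and> dm C f = G0 (dm D g) \<and> cd C f = G0 (cd D g))" for g
  have F0: "F0 x \<in> Ob D" if "x \<in> Ob C" for x
    using bij that by (auto simp: bij_betw_def)
  have G0: "G0 y \<in> Ob C" "F0 (G0 y) = y" if "y \<in> Ob D" for y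
    using bij that unfolding G0_def bij_betw_def by (auto intro: inv_into_into f_inv_into_f)
  have GF: "G0 (F0 x) = x" if "x \<in> Ob C" for x
    using bij that unfolding G0_def bij_betw_def by simp
  have G1: "G1 g \<in> Ar C \<and> dm C (G1 g) = G0 (dm D g) \<and> cd C (G1 g) = G0 (cd D g)" if "g \<in> Ar D" for g
    unfolding G1_def by (rule theI') (use that in \<open>simp add: C.ex1_Ar D.dm_Ob D.cd_Ob G0\<close>)
  have "G1 (F1 f) = f" if f: "f \<in> Ar C" for f
    using F1[OF f] G1[of "F1 f"] f by (intro C.Ar_eqI) (simp_all add: GF C.dm_Ob C.cd_Ob)
  moreover have "F1 (G1 g) = g" if g: "g \<in> Ar D" for g
    using G1[OF g] F1[of "G1 g"] g by (intro D.Ar_eqI) (simp_all add: G0 D.dm_Ob D.cd_Ob)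
  moreover have "cat_functor C D F0 F1"
    using C D F0 F1 by (rule cat_functor_indiscrete)
  moreover have "cat_functor D C G0 G1"
    using D C G0(1) G1 by (rule cat_functor_indiscrete)
  ultimately show ?thesis
    unfolding cat_iso_def using GF G0 by blast
qed


section \<open>Locally indiscrete 2-categories\<close>

locale locally_indiscrete = two_category +
  assumes ex1_Cell: "\<lbrakk>f \<in> Mor A; g \<in> Mor A; Dom A f = Dom A g; Cod A f = Cod A g\<rbrakk> \<Longrightarrow>
    \<exists>!\<alpha>. \<alpha> \<in> Cell A \<and> Src A \<alpha> = f \<and> Tgt A \<alpha> = g"
begin

lemma Cell_eqI: "\<lbrakk>\<alpha> \<in> Cell A; \<beta> \<in> Cell A; Src A \<alpha> = Src A \<beta>; Tgt A \<alpha> = Tgt A \<beta>\<rbrakk> \<Longrightarrow> \<alpha> = \<beta>"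
  using ex1_Cell[of "Src A \<alpha>" "Tgt A \<alpha>"] Cell_boundary[of \<alpha>] by auto

lemma indiscrete_hom_cat: "indiscrete_cat (hom_cat A X Y)"
proof
  fix f g assume "f \<in> Ob (hom_cat A X Y)" "g \<in> Ob (hom_cat A X Y)"
  then show "\<exists>!\<alpha>. \<alpha> \<in> Ar (hom_cat A X Y) \<and> dm (hom_cat A X Y) \<alpha> = f \<and> cd (hom_cat A X Y) \<alpha> = g"
    using ex1_Cell[of f g] by (auto simp: hom_cat_def)
qed (use Cell_boundary Id2_Cell VComp_Cell in \<open>auto simp: hom_cat_def\<close>)

end

section \<open>The functor 2-category over a locally indiscrete 2-category\<close>

lemma functor_twocat_simps:
  "Dom (functor_twocat I A) = nat_src" "Cod (functor_twocat I A) = nat_tgt"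
  "Src (functor_twocat I A) = mod_src" "Tgt (functor_twocat I A) = mod_tgt"
  "Comp (functor_twocat I A) \<nu> \<mu> = \<lparr>nat_src = nat_src \<mu>, nat_tgt = nat_tgt \<nu>,
     nat_at = (\<lambda>i\<in>Obj I. nat_at \<nu> i \<odot>\<^bsub>A\<^esub> nat_at \<mu> i)\<rparr>"
  "Id2 (functor_twocat I A) \<mu> = \<lparr>mod_src = \<mu>, mod_tgt = \<mu>,
     mod_at = (\<lambda>i\<in>Obj I. Id2 A (nat_at \<mu> i))\<rparr>"
  "VComp (functor_twocat I A) \<psi> \<phi> = \<lparr>mod_src = mod_src \<phi>, mod_tgt = mod_tgt \<psi>,
     mod_at = (\<lambda>i\<in>Obj I. mod_at \<psi> i \<cdot>\<^bsub>A\<^esub> mod_at \<phi> i)\<rparr>"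
  "HComp (functor_twocat I A) \<psi> \<phi> = \<lparr>
     mod_src = Comp (functor_twocat I A) (mod_src \<psi>) (mod_src \<phi>),
     mod_tgt = Comp (functor_twocat I A) (mod_tgt \<psi>) (mod_tgt \<phi>),
     mod_at = (\<lambda>i\<in>Obj I. mod_at \<psi> i \<star>\<^bsub>A\<^esub> mod_at \<phi> i)\<rparr>"
  by (simp_all add: functor_twocat_def Let_def)

lemma Obj_functor_twocat: "F \<in> Obj (functor_twocat I A) \<longleftrightarrow> two_functor I A F \<and>
    fun0 F \<in> extensional (Obj I) \<and> fun1 F \<in> extensional (Mor I) \<and> fun2 F \<in> extensional (Cell I)"
  by (simp add: functor_twocat_def Let_def)

lemma Mor_functor_twocat: "\<mu> \<in> Mor (functor_twocat I A) \<longleftrightarrow>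
    nat_src \<mu> \<in> Obj (functor_twocat I A) \<and> nat_tgt \<mu> \<in> Obj (functor_twocat I A) \<and>
    two_natural I A \<mu> \<and> nat_at \<mu> \<in> extensional (Obj I)"
  by (simp add: functor_twocat_def Let_def)

lemma Cell_functor_twocat: "\<phi> \<in> Cell (functor_twocat I A) \<longleftrightarrow>
    mod_src \<phi> \<in> Mor (functor_twocat I A) \<and> mod_tgt \<phi> \<in> Mor (functor_twocat I A) \<and>
    modification I A \<phi> \<and> mod_at \<phi> \<in> extensional (Obj I)"
  by (simp add: functor_twocat_def Let_def)

context two_category
begin

lemma diag0_Obj:
  assumes "two_category I" "X \<in> Obj A"
  shows "diag0 I A X \<in> Obj (functor_twocat I A)"
proof -
  interpret I: two_category I by fact
  note X = Id1_Mor[OF assms(2)]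
  note Id = Comp_Id1_left[of "Id1 A X"] Id2_Cell[of "Id1 A X"] HComp_Id2[of "Id1 A X" "Id1 A X"]
    VComp_Id2_left[of "Id2 A (Id1 A X)"]
  have "two_functor I A (diag0 I A X)"
    by unfold_locales
      (use assms(2) X Id I.Dom_Obj I.Cod_Obj I.Id1_Mor I.Comp_Mor I.Cell_boundary I.Id2_Cell
          I.VComp_Cell I.HComp_Cell in \<open>simp_all add: diag0_def\<close>)
  then show ?thesis
    by (simp add: Obj_functor_twocat diag0_def)
qed

end

locale locally_indiscrete_functors = I: two_category I + A: locally_indiscrete A
  for I :: "('i, 'j, 'k) twocat" and A :: "('o, 'm, 'c) twocat"
begin

abbreviation "B \<equiv> functor_twocat I A"

text \<open>Naturality of a modification equates two parallel 2-morphisms of \<open>A\<close>, so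
  local indiscreteness supplies it as soon as the components have the right boundary.\<close>

lemma Cell_B_I:
  assumes "mod_src \<phi> \<in> Mor B" "mod_tgt \<phi> \<in> Mor B"
    and "nat_src (mod_src \<phi>) = nat_src (mod_tgt \<phi>)" "nat_tgt (mod_src \<phi>) = nat_tgt (mod_tgt \<phi>)"
    and at: "\<And>i. i \<in> Obj I \<Longrightarrow> mod_at \<phi> i \<in> Cell A \<and>
        Src A (mod_at \<phi> i) = nat_at (mod_src \<phi>) i \<and> Tgt A (mod_at \<phi> i) = nat_at (mod_tgt \<phi>) i"
    and "mod_at \<phi> \<in> extensional (Obj I)"
  shows "\<phi> \<in> Cell B"
proof -
  interpret \<mu>: two_natural I A "mod_src \<phi>" using assms by (simp add: Mor_functor_twocat)
  interpret \<nu>: two_natural I A "mod_tgt \<phi>" using assms by (simp add: Mor_functor_twocat)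
  interpret F: two_functor I A "nat_src (mod_tgt \<phi>)"
    using assms by (simp add: Mor_functor_twocat Obj_functor_twocat)
  interpret G: two_functor I A "nat_tgt (mod_tgt \<phi>)"
    using assms by (simp add: Mor_functor_twocat Obj_functor_twocat)
  have "modification I A \<phi>"
  proof
    fix u assume u: "u \<in> Mor I"
    note d = I.Dom_Obj[OF u] I.Cod_Obj[OF u]
    note fu = F.fun1_Mor[OF u] G.fun1_Mor[OF u]
    note t = d[THEN at] d[THEN \<mu>.nat_at_Mor] d[THEN \<nu>.nat_at_Mor] fu
      fu[THEN conjunct1, THEN A.Id2_Cell]
    show "Id2 A (fun1 (nat_tgt (mod_src \<phi>)) u) \<star>\<^bsub>A\<^esub> mod_at \<phi> (Dom I u) =
        mod_at \<phi> (Cod I u) \<star>\<^bsub>A\<^esub> Id2 A (fun1 (nat_src (mod_src \<phi>)) u)"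
      \<comment> \<open>The two whiskerings are parallel because the source and the target of the
        modification are themselves natural at \<open>u\<close>.\<close>
      by (rule A.Cell_eqI)
        (use t \<mu>.naturality1[OF u] \<nu>.naturality1[OF u] assms(3,4) in \<open>simp_all add: A.HComp_Cell\<close>)
  qed (use assms in auto)
  then show ?thesis
    using assms by (simp add: Cell_functor_twocat)
qed

lemma Cell_B_D:
  assumes "\<phi> \<in> Cell B"
  shows "mod_src \<phi> \<in> Mor B" "mod_tgt \<phi> \<in> Mor B"
    "nat_src (mod_src \<phi>) = nat_src (mod_tgt \<phi>)" "nat_tgt (mod_src \<phi>) = nat_tgt (mod_tgt \<phi>)"
    "mod_at \<phi> \<in> extensional (Obj I)"
    "i \<in> Obj I \<Longrightarrow> mod_at \<phi> i \<in> Cell A \<and>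
        Src A (mod_at \<phi> i) = nat_at (mod_src \<phi>) i \<and> Tgt A (mod_at \<phi> i) = nat_at (mod_tgt \<phi>) i"
  using assms by (auto simp: Cell_functor_twocat modification_def)

lemma Cell_B_eqI:
  assumes "\<phi> \<in> Cell B" "\<psi> \<in> Cell B" "mod_src \<phi> = mod_src \<psi>" "mod_tgt \<phi> = mod_tgt \<psi>"
  shows "\<phi> = \<psi>"
proof -
  have "mod_at \<phi> = mod_at \<psi>"
  proof (rule extensionalityI)
    fix i assume "i \<in> Obj I"
    with assms show "mod_at \<phi> i = mod_at \<psi> i"
      using Cell_B_D(6)[of \<phi> i] Cell_B_D(6)[of \<psi> i] by (intro A.Cell_eqI) auto
  qed (use assms Cell_B_D in auto)
  with assms show ?thesis by simp
qed

lemma Mor_B_nat_at: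
  assumes "\<mu> \<in> Mor B" "i \<in> Obj I"
  shows "nat_at \<mu> i \<in> Mor A \<and> Dom A (nat_at \<mu> i) = fun0 (nat_src \<mu>) i \<and>
    Cod A (nat_at \<mu> i) = fun0 (nat_tgt \<mu>) i"
  using assms two_natural.nat_at_Mor[of I A \<mu> i] by (simp add: Mor_functor_twocat)

lemma Id2_B: "\<mu> \<in> Mor B \<Longrightarrow> Id2 B \<mu> \<in> Cell B"
  by (rule Cell_B_I) (auto simp: functor_twocat_simps A.Id2_Cell Mor_B_nat_at)

lemma VComp_B: "\<lbrakk>\<phi> \<in> Cell B; \<psi> \<in> Cell B; mod_src \<psi> = mod_tgt \<phi>\<rbrakk> \<Longrightarrow> \<psi> \<cdot>\<^bsub>B\<^esub> \<phi> \<in> Cell B"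
  using Cell_B_D(3,4)[of \<phi>] Cell_B_D(3,4)[of \<psi>]
  by (intro Cell_B_I) (auto simp: functor_twocat_simps A.VComp_Cell Cell_B_D)

text \<open>Local indiscreteness passes from \<open>A\<close> to \<open>B\<close>: the unique
  2-morphisms between corresponding components form a family, which \<open>Cell_B_I\<close> turns
  into a modification.\<close>

lemma ex1_Cell_B:
  assumes "\<mu> \<in> Mor B" "\<nu> \<in> Mor B" "nat_src \<mu> = nat_src \<nu>" "nat_tgt \<mu> = nat_tgt \<nu>"
  shows "\<exists>!\<phi>. \<phi> \<in> Cell B \<and> mod_src \<phi> = \<mu> \<and> mod_tgt \<phi> = \<nu>"
proof (rule ex_ex1I)
  let ?c = "\<lambda>i. THE \<alpha>. \<alpha> \<in> Cell A \<and> Src A \<alpha> = nat_at \<mu> i \<and> Tgt A \<alpha> = nat_at \<nu> i"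
  have "?c i \<in> Cell A \<and> Src A (?c i) = nat_at \<mu> i \<and> Tgt A (?c i) = nat_at \<nu> i" if "i \<in> Obj I" for i
    by (rule theI', rule A.ex1_Cell) (use assms that in \<open>simp_all add: Mor_B_nat_at\<close>)
  then have "\<lparr>mod_src = \<mu>, mod_tgt = \<nu>, mod_at = restrict ?c (Obj I)\<rparr> \<in> Cell B"
    using assms by (intro Cell_B_I) auto
  then show "\<exists>\<phi>. \<phi> \<in> Cell B \<and> mod_src \<phi> = \<mu> \<and> mod_tgt \<phi> = \<nu>"
    by (intro exI conjI) (assumption, simp_all)
qed (auto intro: Cell_B_eqI)

text \<open>The inverse is the unique modification in the opposite direction; both composites are
  parallel to identities.\<close>

lemma invertible_cell_B: "\<phi> \<in> Cell B \<Longrightarrow> invertible_cell B \<phi>"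
proof -
  assume \<phi>: "\<phi> \<in> Cell B"
  note d = Cell_B_D(1-4)[OF \<phi>]
  obtain \<psi> where \<psi>: "\<psi> \<in> Cell B" "mod_src \<psi> = mod_tgt \<phi>" "mod_tgt \<psi> = mod_src \<phi>"
    using ex1_Cell_B[of "mod_tgt \<phi>" "mod_src \<phi>"] d by auto
  have "\<psi> \<cdot>\<^bsub>B\<^esub> \<phi> = Id2 B (mod_src \<phi>)" "\<phi> \<cdot>\<^bsub>B\<^esub> \<psi> = Id2 B (mod_tgt \<phi>)"
    by (rule Cell_B_eqI; use \<phi> \<psi> d VComp_B[of \<phi> \<psi>] VComp_B[of \<psi> \<phi>] Id2_B in \<open>simp add: functor_twocat_simps\<close>)+
  with \<phi> \<psi> show ?thesis
    unfolding invertible_cell_def by (auto simp: functor_twocat_simps)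
qed

lemma indiscrete_hom_cat_B: "indiscrete_cat (hom_cat B F G)"
proof
  fix \<mu> \<nu> assume "\<mu> \<in> Ob (hom_cat B F G)" "\<nu> \<in> Ob (hom_cat B F G)"
  then show "\<exists>!\<phi>. \<phi> \<in> Ar (hom_cat B F G) \<and> dm (hom_cat B F G) \<phi> = \<mu> \<and> cd (hom_cat B F G) \<phi> = \<nu>"
    using ex1_Cell_B[of \<mu> \<nu>] by (auto simp: hom_cat_def functor_twocat_simps)
next
  fix \<phi> \<psi>
  assume "\<phi> \<in> Ar (hom_cat B F G)" "\<psi> \<in> Ar (hom_cat B F G)"
    "dm (hom_cat B F G) \<psi> = cd (hom_cat B F G) \<phi>"
  then show "cmp (hom_cat B F G) \<psi> \<phi> \<in> Ar (hom_cat B F G) \<and>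
      dm (hom_cat B F G) (cmp (hom_cat B F G) \<psi> \<phi>) = dm (hom_cat B F G) \<phi> \<and>
      cd (hom_cat B F G) (cmp (hom_cat B F G) \<psi> \<phi>) = cd (hom_cat B F G) \<psi>"
    using VComp_B[of \<phi> \<psi>] by (auto simp: hom_cat_def functor_twocat_simps)
qed (use Cell_B_D Id2_B in \<open>auto simp: hom_cat_def functor_twocat_simps\<close>)

text \<open>The 2-dimensional naturality condition comes for free: its two sides have equal sources
  by naturality at \<open>Src I \<theta>\<close> and equal targets by naturality at
  \<open>Tgt I \<theta>\<close>.\<close>

lemma Mor_B_I:
  assumes "nat_src \<mu> \<in> Obj B" "nat_tgt \<mu> \<in> Obj B"
    and at: "\<And>i. i \<in> Obj I \<Longrightarrow> nat_at \<mu> i \<in> Mor A \<and>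
        Dom A (nat_at \<mu> i) = fun0 (nat_src \<mu>) i \<and> Cod A (nat_at \<mu> i) = fun0 (nat_tgt \<mu>) i"
    and nat: "\<And>u. u \<in> Mor I \<Longrightarrow> fun1 (nat_tgt \<mu>) u \<odot>\<^bsub>A\<^esub> nat_at \<mu> (Dom I u) =
        nat_at \<mu> (Cod I u) \<odot>\<^bsub>A\<^esub> fun1 (nat_src \<mu>) u"
    and "nat_at \<mu> \<in> extensional (Obj I)"
  shows "\<mu> \<in> Mor B"
proof -
  interpret F: two_functor I A "nat_src \<mu>" using assms by (simp add: Obj_functor_twocat)
  interpret G: two_functor I A "nat_tgt \<mu>" using assms by (simp add: Obj_functor_twocat)
  have "two_natural I A \<mu>"
  proof
    fix \<theta> assume \<theta>: "\<theta> \<in> Cell I"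
    note b = I.Cell_boundary[OF \<theta>]
    then have s: "Src I \<theta> \<in> Mor I" and t: "Tgt I \<theta> \<in> Mor I" by auto
    note d = I.Dom_Obj[OF s] I.Cod_Obj[OF s]
    note types = d[THEN at] d[THEN at, THEN conjunct1, THEN A.Id2_Cell] F.fun1_Mor[OF s]
      G.fun1_Mor[OF s] F.fun2_Cell[OF \<theta>] G.fun2_Cell[OF \<theta>]
    show "fun2 (nat_tgt \<mu>) \<theta> \<star>\<^bsub>A\<^esub> Id2 A (nat_at \<mu> (Dom I (Src I \<theta>))) =
        Id2 A (nat_at \<mu> (Cod I (Src I \<theta>))) \<star>\<^bsub>A\<^esub> fun2 (nat_src \<mu>) \<theta>"
      by (rule A.Cell_eqI) (use types b nat[OF s] nat[OF t] in \<open>simp_all add: A.HComp_Cell\<close>)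
  qed (use assms in auto)
  then show ?thesis
    using assms by (simp add: Mor_functor_twocat)
qed

lemma whisker_cone_Mor:
  assumes "\<pi> \<in> Mor B" "nat_src \<pi> = diag0 I A L" and f: "f \<in> Mor A" "Cod A f = L"
  shows "\<pi> \<odot>\<^bsub>B\<^esub> diag1 I A f \<in> Mor B"
proof (rule Mor_B_I)
  interpret \<pi>: two_natural I A \<pi> using assms by (simp add: Mor_functor_twocat)
  interpret F: two_functor I A "nat_tgt \<pi>"
    using assms by (simp add: Mor_functor_twocat Obj_functor_twocat)
  fix u assume u: "u \<in> Mor I"
  note d = I.Dom_Obj[OF u] I.Cod_Obj[OF u]
  note p = d[THEN \<pi>.nat_at_Mor]
  \<comment> \<open>As the source of \<open>\<pi>\<close> is constant, its naturality square
    degenerates to the triangle of a cone.\<close>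
  have "fun1 (nat_tgt \<pi>) u \<odot>\<^bsub>A\<^esub> nat_at \<pi> (Dom I u) = nat_at \<pi> (Cod I u)"
    using \<pi>.naturality1[OF u] u d p assms A.Comp_Id1_right[of "nat_at \<pi> (Cod I u)"]
    by (simp add: diag0_def)
  then have "fun1 (nat_tgt \<pi>) u \<odot>\<^bsub>A\<^esub> (nat_at \<pi> (Dom I u) \<odot>\<^bsub>A\<^esub> f) = nat_at \<pi> (Cod I u) \<odot>\<^bsub>A\<^esub> f"
    using p d f assms F.fun1_Mor[OF u] by (subst A.Comp_assoc) (auto simp: diag0_def)
  moreover have "nat_at \<pi> (Cod I u) \<odot>\<^bsub>A\<^esub> f \<odot>\<^bsub>A\<^esub> Id1 A (Dom A f) = nat_at \<pi> (Cod I u) \<odot>\<^bsub>A\<^esub> f"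
    using A.Comp_Id1_right[of "nat_at \<pi> (Cod I u) \<odot>\<^bsub>A\<^esub> f"] A.Comp_Mor[of f "nat_at \<pi> (Cod I u)"]
      p d f assms by (simp add: diag0_def)
  ultimately show "fun1 (nat_tgt (\<pi> \<odot>\<^bsub>B\<^esub> diag1 I A f)) u \<odot>\<^bsub>A\<^esub> nat_at (\<pi> \<odot>\<^bsub>B\<^esub> diag1 I A f) (Dom I u) =
      nat_at (\<pi> \<odot>\<^bsub>B\<^esub> diag1 I A f) (Cod I u) \<odot>\<^bsub>A\<^esub> fun1 (nat_src (\<pi> \<odot>\<^bsub>B\<^esub> diag1 I A f)) u"
    using u d by (simp add: functor_twocat_simps diag1_def diag0_def)
next
  fix i assume "i \<in> Obj I"
  then show "nat_at (\<pi> \<odot>\<^bsub>B\<^esub> diag1 I A f) i \<in> Mor A \<and>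
      Dom A (nat_at (\<pi> \<odot>\<^bsub>B\<^esub> diag1 I A f) i) = fun0 (nat_src (\<pi> \<odot>\<^bsub>B\<^esub> diag1 I A f)) i \<and>
      Cod A (nat_at (\<pi> \<odot>\<^bsub>B\<^esub> diag1 I A f) i) = fun0 (nat_tgt (\<pi> \<odot>\<^bsub>B\<^esub> diag1 I A f)) i"
    using Mor_B_nat_at[OF assms(1), of i] assms
    by (simp add: functor_twocat_simps diag1_def diag0_def A.Comp_Mor)
qed (use assms in \<open>simp_all add: functor_twocat_simps diag1_def A.diag0_Obj[OF I.two_category_axioms]
      A.Dom_Obj Mor_functor_twocat\<close>)

lemma whisker_cone_Cell:
  assumes \<pi>: "\<pi> \<in> Mor B" "nat_src \<pi> = diag0 I A L" and \<alpha>: "\<alpha> \<in> Cell A" "Cod A (Src A \<alpha>) = L"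
  shows "Id2 B \<pi> \<star>\<^bsub>B\<^esub> diag2 I A \<alpha> \<in> Cell B"
proof (rule Cell_B_I)
  note b = A.Cell_boundary[OF \<alpha>(1)]
  show "mod_src (Id2 B \<pi> \<star>\<^bsub>B\<^esub> diag2 I A \<alpha>) \<in> Mor B" "mod_tgt (Id2 B \<pi> \<star>\<^bsub>B\<^esub> diag2 I A \<alpha>) \<in> Mor B"
    using whisker_cone_Mor[OF \<pi>, of "Src A \<alpha>"] whisker_cone_Mor[OF \<pi>, of "Tgt A \<alpha>"] \<alpha> b
    by (simp_all add: functor_twocat_simps diag2_def)
  fix i assume i: "i \<in> Obj I"
  note p = Mor_B_nat_at[OF \<pi>(1) i]
  show "mod_at (Id2 B \<pi> \<star>\<^bsub>B\<^esub> diag2 I A \<alpha>) i \<in> Cell A \<and>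
    Src A (mod_at (Id2 B \<pi> \<star>\<^bsub>B\<^esub> diag2 I A \<alpha>) i) = nat_at (mod_src (Id2 B \<pi> \<star>\<^bsub>B\<^esub> diag2 I A \<alpha>)) i \<and>
    Tgt A (mod_at (Id2 B \<pi> \<star>\<^bsub>B\<^esub> diag2 I A \<alpha>) i) = nat_at (mod_tgt (Id2 B \<pi> \<star>\<^bsub>B\<^esub> diag2 I A \<alpha>)) i"
    using i p \<pi> \<alpha> b A.HComp_Cell[of \<alpha> "Id2 A (nat_at \<pi> i)"] A.Id2_Cell[of "nat_at \<pi> i"]
    by (simp add: functor_twocat_simps diag2_def diag1_def diag0_def)
qed (use A.Cell_boundary[OF \<alpha>(1)] in \<open>simp_all add: functor_twocat_simps diag2_def diag1_def\<close>)

text \<open>Over locally indiscrete 2-categories the 2-dimensional part of the universal property is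
  automatic.\<close>

lemma is_two_limitI:
  assumes \<pi>: "(L, \<pi>) \<in> two_cones I A F"
    and bij: "\<And>X. X \<in> Obj A \<Longrightarrow> bij_betw (\<lambda>f. \<pi> \<odot>\<^bsub>B\<^esub> diag1 I A f)
      {f \<in> Mor A. Dom A f = X \<and> Cod A f = L} {\<mu> \<in> Mor B. nat_src \<mu> = diag0 I A X \<and> nat_tgt \<mu> = F}"
  shows "is_two_limit I A F (L, \<pi>)"
proof -
  have p: "\<pi> \<in> Mor B" "nat_src \<pi> = diag0 I A L" "nat_tgt \<pi> = F"
    using \<pi> by (auto simp: two_cones_def)
  have "cat_iso (hom_cat A X L) (hom_cat B (diag0 I A X) F)
      (\<lambda>f. \<pi> \<odot>\<^bsub>B\<^esub> diag1 I A f) (\<lambda>\<alpha>. Id2 B \<pi> \<star>\<^bsub>B\<^esub> diag2 I A \<alpha>)" if X: "X \<in> Obj A" for X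
  proof (rule cat_iso_indiscrete[OF A.indiscrete_hom_cat indiscrete_hom_cat_B])
    show "bij_betw (\<lambda>f. \<pi> \<odot>\<^bsub>B\<^esub> diag1 I A f) (Ob (hom_cat A X L)) (Ob (hom_cat B (diag0 I A X) F))"
      using bij[OF X] by (simp add: hom_cat_def functor_twocat_simps)
  next
    fix \<alpha> assume "\<alpha> \<in> Ar (hom_cat A X L)"
    then show "Id2 B \<pi> \<star>\<^bsub>B\<^esub> diag2 I A \<alpha> \<in> Ar (hom_cat B (diag0 I A X) F) \<and>
        dm (hom_cat B (diag0 I A X) F) (Id2 B \<pi> \<star>\<^bsub>B\<^esub> diag2 I A \<alpha>) =
          \<pi> \<odot>\<^bsub>B\<^esub> diag1 I A (dm (hom_cat A X L) \<alpha>) \<and>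
        cd (hom_cat B (diag0 I A X) F) (Id2 B \<pi> \<star>\<^bsub>B\<^esub> diag2 I A \<alpha>) =
          \<pi> \<odot>\<^bsub>B\<^esub> diag1 I A (cd (hom_cat A X L) \<alpha>)"
      using whisker_cone_Cell[OF p(1,2), of \<alpha>] p
      by (simp add: hom_cat_def functor_twocat_simps diag2_def diag1_def)
  qed
  with \<pi> show ?thesis
    by (simp add: is_two_limit_def)
qed

text \<open>Local indiscreteness gives a 2-morphism from \<open>k\<close> to \<open>h\<close>.
  Whiskered with \<open>\<pi>\<close> it becomes a modification into the cone over \<open>h\<close>,
  invertible because all modifications are. So every \<open>k\<close> parallel to \<open>h\<close>
  underlies a morphism of the pseudo-slice.\<close>

lemma whisker_ps_morphism:
  assumes \<pi>: "(L, \<pi>) \<in> two_cones I A F"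
    and h: "h \<in> Mor A" "Dom A h = X" "Cod A h = L" and k: "k \<in> Mor A" "Dom A k = X" "Cod A k = L"
  shows "\<exists>\<phi>. ((X, \<pi> \<odot>\<^bsub>B\<^esub> diag1 I A h), (k, \<phi>), (L, \<pi>)) \<in> ps_morphisms I A F"
proof -
  have p: "\<pi> \<in> Mor B" "nat_src \<pi> = diag0 I A L" "nat_tgt \<pi> = F"
    using \<pi> by (auto simp: two_cones_def)
  obtain \<alpha> where \<alpha>: "\<alpha> \<in> Cell A" "Src A \<alpha> = k" "Tgt A \<alpha> = h"
    using A.ex1_Cell[of k h] h k by auto
  have "(X, \<pi> \<odot>\<^bsub>B\<^esub> diag1 I A h) \<in> two_cones I A F"
    using whisker_cone_Mor[OF p(1,2), of h] h p A.Dom_Obj[of h]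
    by (auto simp: two_cones_def functor_twocat_simps diag1_def)
  then have "((X, \<pi> \<odot>\<^bsub>B\<^esub> diag1 I A h), (k, Id2 B \<pi> \<star>\<^bsub>B\<^esub> diag2 I A \<alpha>), (L, \<pi>)) \<in> ps_morphisms I A F"
    using \<pi> k \<alpha> invertible_cell_B[OF whisker_cone_Cell[OF p(1,2), of \<alpha>]]
    by (simp add: ps_morphisms_def functor_twocat_simps diag2_def)
  then show ?thesis ..
qed

text \<open>Both \<open>h\<close> and \<open>k\<close> underlie morphisms from the cone induced by
  \<open>h\<close> to \<open>\<pi>\<close>, whereas 2-terminality leaves room for one morphism
  only.\<close>

lemma two_terminal_pseudo_sliceD:
  assumes "two_terminal (pseudo_slice I A F) (L, \<pi>)"
    and h: "h \<in> Mor A" "Cod A h = L" and k: "k \<in> Mor A" "Cod A k = L" and "Dom A h = Dom A k"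
  shows "h = k"
proof -
  have \<pi>: "(L, \<pi>) \<in> two_cones I A F"
    using assms(1) by (simp add: two_terminal_def pseudo_slice_def)
  let ?x = "(Dom A h, \<pi> \<odot>\<^bsub>B\<^esub> diag1 I A h)"
  obtain \<phi> \<psi> where \<phi>: "(?x, (h, \<phi>), (L, \<pi>)) \<in> ps_morphisms I A F"
    and \<psi>: "(?x, (k, \<psi>), (L, \<pi>)) \<in> ps_morphisms I A F"
    using whisker_ps_morphism[OF \<pi> h(1) refl h(2)] h k assms(6) by metis
  have "?x \<in> two_cones I A F"
    using \<phi> by (simp add: ps_morphisms_def)
  then obtain F0 F1 where "cat_iso (hom_cat (pseudo_slice I A F) ?x (L, \<pi>)) terminal_cat F0 F1"
    using assms(1) by (auto simp: two_terminal_def pseudo_slice_def isomorphic_cat_def)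
  then have "p = q" if "p \<in> Ob (hom_cat (pseudo_slice I A F) ?x (L, \<pi>))"
      "q \<in> Ob (hom_cat (pseudo_slice I A F) ?x (L, \<pi>))" for p q
    using that unfolding cat_iso_def by (metis old.unit.exhaust)
  from this[of "(?x, (h, \<phi>), (L, \<pi>))" "(?x, (k, \<psi>), (L, \<pi>))"] \<phi> \<psi> show "h = k"
    by (simp add: hom_cat_def pseudo_slice_def)
qed

end


section \<open>The presented 2-category\<close>

context two_category
begin

text \<open>By interchange the horizontal composite of the inverses is an inverse.\<close>

lemma invertible_HComp:
  assumes "invertible_cell A \<alpha>" "invertible_cell A \<beta>" and c: "Dom A (Src A \<beta>) = Cod A (Src A \<alpha>)"
  shows "invertible_cell A (\<beta> \<star> \<alpha>)"
proof -
  obtain \<alpha>' where a: "\<alpha> \<in> Cell A" "\<alpha>' \<in> Cell A" "Src A \<alpha>' = Tgt A \<alpha>" "Tgt A \<alpha>' = Src A \<alpha>"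
    "\<alpha>' \<cdot> \<alpha> = Id2 A (Src A \<alpha>)" "\<alpha> \<cdot> \<alpha>' = Id2 A (Tgt A \<alpha>)"
    using assms(1) by (auto simp: invertible_cell_def)
  obtain \<beta>' where b: "\<beta> \<in> Cell A" "\<beta>' \<in> Cell A" "Src A \<beta>' = Tgt A \<beta>" "Tgt A \<beta>' = Src A \<beta>"
    "\<beta>' \<cdot> \<beta> = Id2 A (Src A \<beta>)" "\<beta> \<cdot> \<beta>' = Id2 A (Tgt A \<beta>)"
    using assms(2) by (auto simp: invertible_cell_def)
  note bd = Cell_boundary[OF a(1)] Cell_boundary[OF b(1)]
  have c': "Dom A (Src A \<beta>') = Cod A (Src A \<alpha>')"
    using a b bd c by simp
  have "(\<beta>' \<star> \<alpha>') \<cdot> (\<beta> \<star> \<alpha>) = Id2 A (Src A \<beta> \<odot> Src A \<alpha>)"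
    using interchange[of \<alpha> \<alpha>' \<beta> \<beta>'] HComp_Id2[of "Src A \<alpha>" "Src A \<beta>"] a b bd c by simp
  moreover have "(\<beta> \<star> \<alpha>) \<cdot> (\<beta>' \<star> \<alpha>') = Id2 A (Tgt A \<beta> \<odot> Tgt A \<alpha>)"
    using interchange[of \<alpha>' \<alpha> \<beta>' \<beta>] HComp_Id2[of "Tgt A \<alpha>" "Tgt A \<beta>"] a b bd c c' by simp
  ultimately show ?thesis
    using HComp_Cell[of \<alpha> \<beta>] HComp_Cell[of \<alpha>' \<beta>'] a b c c'
    unfolding invertible_cell_def by auto
qed

lemma invertible_Id2: "f \<in> Mor A \<Longrightarrow> invertible_cell A (Id2 A f)"
  using Id2_Cell[of f] VComp_Id2_left[of "Id2 A f"] by (auto simp: invertible_cell_def)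

lemma invertible_cancel_left:
  assumes "invertible_cell A \<sigma>" "\<alpha> \<in> Cell A" "\<beta> \<in> Cell A" "Src A \<sigma> = Tgt A \<alpha>" "Src A \<sigma> = Tgt A \<beta>"
    and eq: "\<sigma> \<cdot> \<alpha> = \<sigma> \<cdot> \<beta>"
  shows "\<alpha> = \<beta>"
proof -
  obtain \<tau> where t: "\<sigma> \<in> Cell A" "\<tau> \<in> Cell A" "Src A \<tau> = Tgt A \<sigma>" "\<tau> \<cdot> \<sigma> = Id2 A (Src A \<sigma>)"
    using assms(1) by (auto simp: invertible_cell_def)
  have "\<gamma> = \<tau> \<cdot> (\<sigma> \<cdot> \<gamma>)" if "\<gamma> \<in> Cell A" "Src A \<sigma> = Tgt A \<gamma>" for \<gamma>
    using VComp_assoc[of \<gamma> \<sigma> \<tau>] VComp_Id2_left[of \<gamma>] that t by simp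
  then show ?thesis
    using assms by metis
qed

end

section \<open>Normal forms and the word problem for morphisms\<close>

lemma exP_simps [simp]:
  "gobj exP = UNIV" "gmor exP = UNIV" "gdom exP = gen_dom" "gcod exP = gen_cod"
  "mrel exP = {(MComp (MGen Gb) (MGen Glam0), MComp (MGen Gc) (MGen Glam1))}"
  "gcell exP = UNIV" "gsrc exP c = MGen Gf" "gtgt exP c = MGen Gg" "ginv exP = UNIV"
  by (simp_all add: exP_def)

interpretation exP: wf_presentation exP by (rule wf_exP)

interpretation exA: two_category exA by (rule two_category_exA)

lemmas exA_simps = exP.presented_simps[folded exA_def, unfolded exP_simps]

lemmas Mor_exA_E = exP.Mor_E[folded exA_def]

lemmas Cell_exA_E = exP.Cell_E[folded exA_def]

text \<open>The defining relation does not mention \<open>Gg\<close>, and the unit and associativity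
  laws neither create nor delete generators. Occurrence of \<open>Gg\<close> is thus an invariant of
  the morphism.\<close>

lemma meq_Gg: "meq exP s t \<Longrightarrow> Gg \<in> set2_mterm s \<longleftrightarrow> Gg \<in> set2_mterm t"
  by (induction rule: meq.induct) auto

text \<open>One term for each of the 18 morphisms. Composites through \<open>Gc\<close> after
  \<open>Glam1\<close> are absent, since the relation rewrites them to composites through
  \<open>Gb\<close> after \<open>Glam0\<close>.\<close>

definition normal_forms :: "(gen_ob, gen_ar) mterm set" where
  "normal_forms = range MId \<union> range MGen \<union> {MComp (MGen Gb) (MGen Glam0)} \<union>
     (\<Union>h\<in>{MGen Gf, MGen Gg}. {MComp (MGen Glam0) h, MComp (MGen Glam1) h,
        MComp (MGen Gb) (MComp (MGen Glam0) h)})"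

lemma range_MGen: "range MGen = {MGen Gf, MGen Gg, MGen Glam0, MGen Glam1, MGen Gb, MGen Gc}"
  using gen_ar.exhaust by auto

lemma normal_forms_mwf: "n \<in> normal_forms \<Longrightarrow> mwf exP n"
  by (auto simp: normal_forms_def)

lemma normal_forms_gen:
  assumes "n \<in> normal_forms" "mcod exP n = gen_dom e"
  shows "\<exists>n'\<in>normal_forms. meq exP (MComp (MGen e) n) n'"
proof -
  have rel: "meq exP (MComp (MGen Gc) (MGen Glam1)) (MComp (MGen Gb) (MGen Glam0))"
    by (rule meq_sym, rule meq_rel) simp
  \<comment> \<open>Apart from composites with an identity, prefixing a generator leaves the list
    only when \<open>Gc\<close> meets \<open>Glam1\<close>, alone or followed by \<open>Gf\<close>
    or \<open>Gg\<close>.\<close>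
  consider x where "n = MId x" | "MComp (MGen e) n \<in> normal_forms"
    | "e = Gc" "n = MGen Glam1"
    | h where "e = Gc" "n = MComp (MGen Glam1) h" "h = MGen Gf \<or> h = MGen Gg"
    using assms by (cases e) (auto simp: normal_forms_def range_MGen)
  then show ?thesis
  proof cases
    case 1
    then show ?thesis
      using assms meq_id_right[of exP "MGen e"] by (auto simp: normal_forms_def)
  next
    case 2
    then show ?thesis
      using normal_forms_mwf meq_refl by blast
  next
    case 3
    then show ?thesis
      using rel by (auto simp: normal_forms_def)
  next
    case 4
    \<comment> \<open>The relation applies only after reassociating; a second reassociation then
      restores the right-nested shape.\<close>
    then have "meq exP (MComp (MGen e) n) (MComp (MComp (MGen Gc) (MGen Glam1)) h)"
      by (auto intro!: meq_assoc)
    also have "meq exP \<dots> (MComp (MComp (MGen Gb) (MGen Glam0)) h)"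
      using 4 by (intro meq_comp rel meq_refl) auto
    also (meq_trans) have "meq exP \<dots> (MComp (MGen Gb) (MComp (MGen Glam0) h))"
      using 4 by (intro meq_sym[OF meq_assoc]) auto
    finally (meq_trans) show ?thesis
      using 4 by (auto simp: normal_forms_def)
  qed
qed

text \<open>Quantifying over \<open>n\<close> lets the induction treat a composite \<open>t\<close>
  after \<open>s\<close> in two stages: normalise \<open>s\<close> after \<open>n\<close>, then
  \<open>t\<close> after the result.\<close>

lemma normal_forms_comp:
  "\<lbrakk>mwf exP t; n \<in> normal_forms; mcod exP n = mdom exP t\<rbrakk> \<Longrightarrow>
    \<exists>n'\<in>normal_forms. meq exP (MComp t n) n'"
proof (induction t arbitrary: n)
  case (MId x)
  then show ?case
    using meq_id_left[of exP n] normal_forms_mwf by auto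
next
  case (MGen e)
  then show ?case
    using normal_forms_gen by simp
next
  case (MComp t s)
  then obtain n' where n': "n' \<in> normal_forms" "meq exP (MComp s n) n'"
    by fastforce
  then obtain n'' where n'': "n'' \<in> normal_forms" "meq exP (MComp t n') n''"
    using MComp exP.meq_wf[OF n'(2)] by fastforce
  have w: "mwf exP (MComp t (MComp s n))"
    using MComp normal_forms_mwf by simp
  have "meq exP (MComp (MComp t s) n) (MComp t (MComp s n))"
    using w by (rule meq_sym[OF meq_assoc])
  also have "meq exP \<dots> (MComp t n')"
    using w n'(2) by (intro meq_comp meq_refl) auto
  finally (meq_trans) show ?case
    using n'' meq_trans by blast
qed

text \<open>Let \<open>t\<close> act on the identity of its domain, which is itself a normal
  form.\<close>

lemma normal_form_ex:
  assumes "mwf exP t"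
  obtains n where "n \<in> normal_forms" "meq exP t n"
proof -
  have "MId (mdom exP t) \<in> normal_forms"
    by (simp add: normal_forms_def)
  then obtain n where "n \<in> normal_forms" "meq exP (MComp t (MId (mdom exP t))) n"
    using normal_forms_comp[OF assms] by fastforce
  then show thesis
    using that meq_id_right[OF assms] meq_sym meq_trans by metis
qed

text \<open>A finite check. The only parallel pairs of distinct normal forms start at
  \<open>OX\<close>, and there one contains \<open>Gf\<close> and the other
  \<open>Gg\<close>.\<close>

lemma normal_forms_eqI:
  "\<lbrakk>n \<in> normal_forms; n' \<in> normal_forms; mdom exP n = mdom exP n'; mcod exP n = mcod exP n';
    Gg \<in> set2_mterm n \<longleftrightarrow> Gg \<in> set2_mterm n'\<rbrakk> \<Longrightarrow> n = n'"
  unfolding normal_forms_def range_MGen by (elim UnE UN_E insertE emptyE imageE) simp_all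

lemma meq_exP_iff:
  assumes "mwf exP s" "mwf exP t"
  shows "meq exP s t \<longleftrightarrow> mdom exP s = mdom exP t \<and> mcod exP s = mcod exP t \<and>
    (Gg \<in> set2_mterm s \<longleftrightarrow> Gg \<in> set2_mterm t)" (is "_ \<longleftrightarrow> ?same")
proof
  assume "meq exP s t"
  then show ?same
    using exP.meq_wf meq_Gg by blast
next
  assume same: ?same
  obtain m n where m: "m \<in> normal_forms" "meq exP s m" and n: "n \<in> normal_forms" "meq exP t n"
    using assms normal_form_ex by metis
  have "m = n"
    using m n same exP.meq_wf[OF m(2)] exP.meq_wf[OF n(2)] meq_Gg[OF m(2)] meq_Gg[OF n(2)]
    by (intro normal_forms_eqI) auto
  then show "meq exP s t"
    using m n meq_sym meq_trans by metis
qed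

section \<open>Straightening: every 2-morphism becomes an identity after replacing g by f\<close>

abbreviation collapse :: "(gen_ob, gen_ar) mterm \<Rightarrow> (gen_ob, gen_ar) mterm" where
  "collapse \<equiv> map_mterm (\<lambda>x. x) (\<lambda>e. if e = Gg then Gf else e)"

text \<open>The component at a term of an invertible transformation from the identity to
  \<open>collapse\<close>: the inverse of \<alpha> at every occurrence of \<open>Gg\<close>,
  identities elsewhere, composed horizontally.\<close>

fun straighten :: "(gen_ob, gen_ar) mterm \<Rightarrow> ex_cell" where
  "straighten (MId x) = Id2 exA (mcls exP (MId x))"
| "straighten (MGen e) = (if e = Gg then ccls exP (CInv Galpha) else Id2 exA (mcls exP (MGen e)))"
| "straighten (MComp t s) = straighten t \<star>\<^bsub>exA\<^esub> straighten s"

lemma collapse: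
  "mwf exP t \<Longrightarrow> mwf exP (collapse t) \<and> mdom exP (collapse t) = mdom exP t \<and>
    mcod exP (collapse t) = mcod exP t \<and> Gg \<notin> set2_mterm (collapse t)"
  by (induction t) auto

lemma straighten_Cell:
  "mwf exP t \<Longrightarrow> straighten t \<in> Cell exA \<and> Src exA (straighten t) = mcls exP t \<and>
    Tgt exA (straighten t) = mcls exP (collapse t)"
proof (induction t)
  case (MComp t s)
  then show ?case
    using exA.HComp_Cell[of "straighten s" "straighten t"] collapse[of t] collapse[of s]
    by (simp add: exA_simps)
qed (simp_all add: exA_simps)

lemma invertible_straighten: "mwf exP t \<Longrightarrow> invertible_cell exA (straighten t)"
proof (induction t)
  case (MId x)
  then show ?case
    using exA.invertible_Id2[of "mcls exP (MId x)"] by (simp add: exA_simps)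
next
  case (MGen e)
  have "ccls exP (CInv Galpha) \<cdot>\<^bsub>exA\<^esub> ccls exP (CGen Galpha) = Id2 exA (mcls exP (MGen Gf))"
    "ccls exP (CGen Galpha) \<cdot>\<^bsub>exA\<^esub> ccls exP (CInv Galpha) = Id2 exA (mcls exP (MGen Gg))"
    using ceq_inv_left[of Galpha exP] ceq_inv_right[of Galpha exP]
    by (simp_all add: exA_simps exP.ccls_eq meq_refl)
  then have "invertible_cell exA (ccls exP (CInv Galpha))"
    unfolding invertible_cell_def
    by (auto simp: exA_simps intro!: bexI[of _ "ccls exP (CGen Galpha)"])
  then show ?case
    using exA.invertible_Id2[of "mcls exP (MGen e)"] by (simp add: exA_simps)
next
  case (MComp t s)
  then show ?case
    using straighten_Cell[of t] straighten_Cell[of s] by (simp add: exA.invertible_HComp exA_simps)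
qed

text \<open>Needed to pass from terms to morphisms. At the defining relation both sides are
  composites of identity 2-morphisms, hence identities on equal morphisms; the structural cases are
  the laws of horizontal composition.\<close>

lemma straighten_meq: "meq exP s t \<Longrightarrow> straighten s = straighten t"
proof (induction rule: meq.induct)
  case (meq_rel s t)
  then show ?case
    using exA.HComp_Id2[of "ex_gen Glam0" "ex_gen Gb"] exA.HComp_Id2[of "ex_gen Glam1" "ex_gen Gc"]
      ex_relation ex_gen_Mor
    by (simp flip: ex_gen_def)
next
  case (meq_id_left s)
  then show ?case
    using exA.HComp_Id_left[of "straighten s"] straighten_Cell[of s] by (simp add: exA_simps)
next
  case (meq_id_right s)
  then show ?case
    using exA.HComp_Id_right[of "straighten s"] straighten_Cell[of s] by (simp add: exA_simps)
next
  case (meq_assoc u t s)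
  then show ?case
    using exA.HComp_assoc[of "straighten s" "straighten t" "straighten u"]
      straighten_Cell[of s] straighten_Cell[of t] straighten_Cell[of u] by (simp add: exA_simps)
qed simp_all

text \<open>This is a naturality square whose fourth side, the collapsed 2-morphism, is an identity.
  For \<alpha> it says that the inverse cancels \<alpha>; for the inverse of \<alpha> the
  straightening of the target \<open>Gf\<close> is an identity. Horizontal composites follow by
  interchange.\<close>

lemma straighten_natural:
  "cwf exP a \<Longrightarrow> straighten (ctgt exP a) \<cdot>\<^bsub>exA\<^esub> ccls exP a = straighten (csrc exP a)"
proof (induction a)
  case (CId s)
  then show ?case
    using exA.VComp_Id2_right[of "straighten s"] straighten_Cell[of s] by (simp add: exA_simps)
next
  case (CGen c)
  then show ?case
    using ceq_inv_left[of c exP] by (cases c) (simp add: exA_simps exP.ccls_eq meq_refl)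
next
  case (CInv c)
  then show ?case
    using exA.VComp_Id2_left[of "ccls exP (CInv c)"] by (cases c) (simp add: exA_simps)
next
  case (CV b a)
  let ?t = "straighten (ctgt exP b)"
  have "?t \<cdot>\<^bsub>exA\<^esub> ccls exP (CV b a) = ?t \<cdot>\<^bsub>exA\<^esub> (ccls exP b \<cdot>\<^bsub>exA\<^esub> ccls exP a)"
    using CV.prems by (simp add: exA_simps)
  also have "\<dots> = ?t \<cdot>\<^bsub>exA\<^esub> ccls exP b \<cdot>\<^bsub>exA\<^esub> ccls exP a"
    using CV.prems exP.cwf_bd[of b] exP.cwf_bd[of a] straighten_Cell[of "ctgt exP b"]
    by (intro exA.VComp_assoc) (simp_all add: exA_simps exP.mcls_eq)
  \<comment> \<open>The source of \<open>b\<close> and the target of \<open>a\<close> agree only up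
    to \<open>meq\<close>, so \<open>straighten_meq\<close> is needed to join the two induction
    hypotheses.\<close>
  also have "\<dots> = straighten (ctgt exP a) \<cdot>\<^bsub>exA\<^esub> ccls exP a"
    using CV straighten_meq[of "csrc exP b" "ctgt exP a"] by simp
  finally show ?case
    using CV by simp
next
  case (CH b a)
  note bd = exP.cwf_bd[of b] exP.cwf_bd[of a]
  have "straighten (ctgt exP (CH b a)) \<cdot>\<^bsub>exA\<^esub> ccls exP (CH b a) =
    (straighten (ctgt exP b) \<star>\<^bsub>exA\<^esub> straighten (ctgt exP a)) \<cdot>\<^bsub>exA\<^esub> (ccls exP b \<star>\<^bsub>exA\<^esub> ccls exP a)"
    using CH.prems by (simp add: exA_simps)
  also have "\<dots> = (straighten (ctgt exP b) \<cdot>\<^bsub>exA\<^esub> ccls exP b) \<star>\<^bsub>exA\<^esub> (straighten (ctgt exP a) \<cdot>\<^bsub>exA\<^esub> ccls exP a)"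
    using CH.prems bd straighten_Cell[of "ctgt exP b"] straighten_Cell[of "ctgt exP a"]
    by (intro exA.interchange[symmetric]) (simp_all add: exA_simps)
  finally show ?case
    using CH by simp
qed

text \<open>Existence: straighten \<open>s\<close>, then undo the straightening of \<open>t\<close>.
  Uniqueness: by naturality every 2-morphism from \<open>p\<close> to \<open>q\<close> becomes
  \<open>straighten s\<close> after composition with the invertible
  \<open>straighten t\<close>.\<close>

interpretation exA: locally_indiscrete exA
proof
  fix p q assume pq: "p \<in> Mor exA" "q \<in> Mor exA" "Dom exA p = Dom exA q" "Cod exA p = Cod exA q"
  obtain s where s: "mwf exP s" "p = mcls exP s"
    using pq(1) by (rule Mor_exA_E)
  obtain t where t: "mwf exP t" "q = mcls exP t"
    using pq(2) by (rule Mor_exA_E)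
  note st = straighten_Cell[OF s(1)] straighten_Cell[OF t(1)]
  show "\<exists>!\<alpha>. \<alpha> \<in> Cell exA \<and> Src exA \<alpha> = p \<and> Tgt exA \<alpha> = q"
  proof (rule ex_ex1I)
    obtain \<tau> where \<tau>: "\<tau> \<in> Cell exA" "Src exA \<tau> = Tgt exA (straighten t)" "Tgt exA \<tau> = q"
      using invertible_straighten[OF t(1)] st t by (auto simp: invertible_cell_def)
    \<comment> \<open>Collapsed terms avoid \<open>Gg\<close>, so having the same ends they are
      equal by the solution of the word problem.\<close>
    have "mcls exP (collapse s) = mcls exP (collapse t)"
      using s t pq collapse[OF s(1)] collapse[OF t(1)]
      by (simp add: exP.mcls_eq meq_exP_iff exA_simps)
    then have "Src exA \<tau> = Tgt exA (straighten s)"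
      using \<tau> st by simp
    then show "\<exists>\<alpha>. \<alpha> \<in> Cell exA \<and> Src exA \<alpha> = p \<and> Tgt exA \<alpha> = q"
      using exA.VComp_Cell[of "straighten s" \<tau>] st \<tau> s by auto
  next
    fix \<alpha> \<beta>
    assume \<alpha>: "\<alpha> \<in> Cell exA \<and> Src exA \<alpha> = p \<and> Tgt exA \<alpha> = q"
      and \<beta>: "\<beta> \<in> Cell exA \<and> Src exA \<beta> = p \<and> Tgt exA \<beta> = q"
    have "straighten t \<cdot>\<^bsub>exA\<^esub> \<gamma> = straighten s"
      if \<gamma>: "\<gamma> \<in> Cell exA" "Src exA \<gamma> = p" "Tgt exA \<gamma> = q" for \<gamma>
    proof -
      obtain c where c: "cwf exP c" "\<gamma> = ccls exP c"
        using \<gamma>(1) by (rule Cell_exA_E)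
      then have "meq exP s (csrc exP c)" "meq exP t (ctgt exP c)"
        using \<gamma> s t by (simp_all add: exA_simps flip: exP.mcls_eq)
      then show ?thesis
        using straighten_natural[OF c(1)] straighten_meq[of s] straighten_meq[of t] c(2) by simp
    qed
    then show "\<alpha> = \<beta>"
      using \<alpha> \<beta> st t invertible_straighten[OF t(1)]
      by (intro exA.invertible_cancel_left[of "straighten t" \<alpha> \<beta>]) auto
  qed
qed

section \<open>Occurrence of g as an invariant of morphisms\<close>

text \<open>\<open>meq_Gg\<close> makes the choice of representative immaterial.\<close>

definition uses_g :: "ex_mor \<Rightarrow> bool" where
  "uses_g p \<longleftrightarrow> Gg \<in> set2_mterm (rep p)"

lemma uses_g_mcls: "mwf exP s \<Longrightarrow> uses_g (mcls exP s) \<longleftrightarrow> Gg \<in> set2_mterm s"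
  unfolding uses_g_def using exP.rep_mcls meq_Gg by blast

lemma uses_g_ex_gen: "uses_g (ex_gen e) \<longleftrightarrow> e = Gg"
  by (auto simp: ex_gen_def uses_g_mcls)

lemma uses_g_Comp:
  "\<lbrakk>p \<in> Mor exA; q \<in> Mor exA; Dom exA q = Cod exA p\<rbrakk> \<Longrightarrow>
    uses_g (q \<odot>\<^bsub>exA\<^esub> p) \<longleftrightarrow> uses_g q \<or> uses_g p"
  by (elim Mor_exA_E) (simp add: exA_simps uses_g_mcls)

lemma Mor_exA_eqI:
  "\<lbrakk>p \<in> Mor exA; q \<in> Mor exA; Dom exA p = Dom exA q; Cod exA p = Cod exA q;
    uses_g p \<longleftrightarrow> uses_g q\<rbrakk> \<Longrightarrow> p = q"
  by (elim Mor_exA_E) (simp add: exA_simps uses_g_mcls exP.mcls_eq meq_exP_iff)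

text \<open>Constructs the apex morphism of a factorization. The normal forms ending in
  \<open>OB\<close> are the identity, \<open>Glam0\<close>, and \<open>Glam0\<close> after
  \<open>Gf\<close> or \<open>Gg\<close>; in the last three cases cancelling \<open>Glam0\<close>
  leaves the required morphism.\<close>

lemma ex_Mor_into_OL:
  assumes p: "p \<in> Mor exA" "Cod exA p = OB" and q: "q \<in> Mor exA" "Cod exA q = OC"
    and "Dom exA q = Dom exA p"
  shows "\<exists>h\<in>Mor exA. Dom exA h = Dom exA p \<and> Cod exA h = OL \<and> (uses_g h \<longleftrightarrow> uses_g p)"
proof -
  have nf: "\<exists>n\<in>normal_forms. p = mcls exP n" if "p \<in> Mor exA" for p
  proof -
    obtain s where s: "mwf exP s" "p = mcls exP s"
      using \<open>p \<in> Mor exA\<close> by (rule Mor_exA_E)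
    obtain n where "n \<in> normal_forms" "meq exP s n"
      using s(1) by (rule normal_form_ex)
    then show ?thesis
      using s by (auto simp: exP.mcls_eq)
  qed
  obtain n m where n: "n \<in> normal_forms" "p = mcls exP n" and m: "m \<in> normal_forms" "q = mcls exP m"
    using nf p q by meson
  note w = normal_forms_mwf[OF n(1)] normal_forms_mwf[OF m(1)]
  have b: "mcod exP n = OB" "mcod exP m = OC" "mdom exP m = mdom exP n"
    using assms n m w by (simp_all add: exA_simps)
  have "n \<in> {MId OB, MGen Glam0, MComp (MGen Glam0) (MGen Gf), MComp (MGen Glam0) (MGen Gg)}"
    using n(1) b(1) unfolding normal_forms_def range_MGen
    by (elim UnE UN_E insertE emptyE imageE) simp_all
  \<comment> \<open>The second leg rules out the identity of \<open>OB\<close>, since no morphism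
    goes from \<open>OB\<close> to \<open>OC\<close>.\<close>
  moreover have "mdom exP m \<noteq> OB"
    using m(1) b(2) unfolding normal_forms_def range_MGen
    by (elim UnE UN_E insertE emptyE imageE) simp_all
  ultimately have "\<exists>h\<in>{MId OL, MGen Gf, MGen Gg}. mdom exP h = mdom exP n \<and> mcod exP h = OL \<and>
      (Gg \<in> set2_mterm h \<longleftrightarrow> Gg \<in> set2_mterm n)"
    using b(3) by auto
  then obtain h where h: "h \<in> {MId OL, MGen Gf, MGen Gg}" "mdom exP h = mdom exP n"
      "mcod exP h = OL" "Gg \<in> set2_mterm h \<longleftrightarrow> Gg \<in> set2_mterm n"
    by blast
  moreover from h(1) have "mwf exP h"
    by auto
  ultimately show ?thesis
    using n w by (intro bexI[of _ "mcls exP h"]) (simp_all add: exA_simps uses_g_mcls)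
qed


section \<open>The 2-limit\<close>

lemma shape_simps [simp]:
  "Obj shape = UNIV" "Mor shape = UNIV" "Cell shape = UNIV" "Dom shape = shape_dm" "Cod shape = shape_cd"
  by (simp_all add: shape_def discrete_twocat_def pullback_shape_def)

interpretation cones: locally_indiscrete_functors shape exA
  by (intro locally_indiscrete_functors.intro two_category_shape exA.locally_indiscrete_axioms)

lemma nat_at_ex_cone [simp]: "nat_at ex_cone = ex_cone_at"
  by (simp add: ex_cone_def)

lemma ex_cone_at_Mor:
  "ex_cone_at i \<in> Mor exA \<and> Dom exA (ex_cone_at i) = OL \<and> Cod exA (ex_cone_at i) = exF0 i"
  using exA.Comp_Mor[of "ex_gen Glam0" "ex_gen Gb"] by (cases i) (simp_all add: ex_gen_Mor)

lemma exF_Obj: "exF \<in> Obj (functor_twocat shape exA)"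
  by (simp add: Obj_functor_twocat two_functor_exF)

lemma ex_cone_two_cones: "(OL, ex_cone) \<in> two_cones shape exA exF"
proof -
  have d: "diag0 shape exA OL \<in> Obj (functor_twocat shape exA)"
    by (rule exA.diag0_Obj[OF two_category_shape]) (simp add: Obj_exA)
  have "ex_cone \<in> Mor (functor_twocat shape exA)"
  proof (rule cones.Mor_B_I)
    fix u
    have "exF1 u \<odot>\<^bsub>exA\<^esub> ex_cone_at (shape_dm u) = ex_cone_at (shape_cd u)"
    proof (cases u)
      case (SId i)
      then show ?thesis
        using exA.Comp_Id1_left[of "ex_cone_at i"] ex_cone_at_Mor[of i] by simp
    \<comment> \<open>At \<open>Sb\<close> this is the choice of the component at \<open>SA\<close>;
      at \<open>Sc\<close> it is the defining relation.\<close>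
    qed (simp_all add: ex_relation)
    also have "\<dots> = ex_cone_at (shape_cd u) \<odot>\<^bsub>exA\<^esub> Id1 exA OL"
      using exA.Comp_Id1_right[of "ex_cone_at (shape_cd u)"] ex_cone_at_Mor[of "shape_cd u"] by simp
    finally show "fun1 (nat_tgt ex_cone) u \<odot>\<^bsub>exA\<^esub> nat_at ex_cone (Dom shape u) =
        nat_at ex_cone (Cod shape u) \<odot>\<^bsub>exA\<^esub> fun1 (nat_src ex_cone) u"
      by (simp add: ex_cone_def exF_def diag0_def)
  qed (use d exF_Obj ex_cone_at_Mor in \<open>simp_all add: ex_cone_def exF_def diag0_def\<close>)
  then show ?thesis
    by (simp add: two_cones_def Obj_exA ex_cone_def)
qed

lemma ex_cone_whisker:
  "nat_at (ex_cone \<odot>\<^bsub>functor_twocat shape exA\<^esub> diag1 shape exA h) i = ex_cone_at i \<odot>\<^bsub>exA\<^esub> h"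
  by (simp add: functor_twocat_simps diag1_def)

text \<open>No component of the cone involves g, so each component of the whiskered cone remembers
  whether \<open>h\<close> does.\<close>

lemma uses_g_ex_cone_whisker:
  assumes "h \<in> Mor exA" "Cod exA h = OL"
  shows "uses_g (ex_cone_at i \<odot>\<^bsub>exA\<^esub> h) \<longleftrightarrow> uses_g h"
proof -
  have "\<not> uses_g (ex_cone_at i)"
    by (cases i) (simp_all add: uses_g_ex_gen uses_g_Comp ex_gen_Mor)
  then show ?thesis
    using assms ex_cone_at_Mor[of i] by (simp add: uses_g_Comp)
qed

lemma ex_cone_factorization:
  assumes \<mu>: "\<mu> \<in> Mor (functor_twocat shape exA)" "nat_src \<mu> = diag0 shape exA X" "nat_tgt \<mu> = exF"
  shows "\<exists>h\<in>Mor exA. Dom exA h = X \<and> Cod exA h = OL \<and>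
    \<mu> = ex_cone \<odot>\<^bsub>functor_twocat shape exA\<^esub> diag1 shape exA h"
proof -
  interpret two_natural shape exA \<mu> using \<mu> by (simp add: Mor_functor_twocat)
  have at: "nat_at \<mu> i \<in> Mor exA \<and> Dom exA (nat_at \<mu> i) = X \<and> Cod exA (nat_at \<mu> i) = exF0 i" for i
    using nat_at_Mor[of i] \<mu> by (simp add: diag0_def exF_def)
  have "exF1 u \<odot>\<^bsub>exA\<^esub> nat_at \<mu> (shape_dm u) = nat_at \<mu> (shape_cd u)" for u
    using naturality1[of u] \<mu> at[of "shape_cd u"] exA.Comp_Id1_right[of "nat_at \<mu> (shape_cd u)"]
    by (simp add: diag0_def exF_def)
  from this[of Sb] this[of Sc]
  have nat: "ex_gen Gb \<odot>\<^bsub>exA\<^esub> nat_at \<mu> SB = nat_at \<mu> SA" "ex_gen Gc \<odot>\<^bsub>exA\<^esub> nat_at \<mu> SC = nat_at \<mu> SA"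
    by simp_all
  \<comment> \<open>Neither \<open>Gb\<close> nor \<open>Gc\<close> involves g, so each leg agrees
    with the component at \<open>SA\<close> on its occurrence.\<close>
  have uses: "uses_g (nat_at \<mu> i) \<longleftrightarrow> uses_g (nat_at \<mu> SA)" for i
  proof (cases i)
    case SB
    then show ?thesis
      using uses_g_Comp[of "nat_at \<mu> SB" "ex_gen Gb"] at[of SB] nat(1)
      by (simp add: ex_gen_Mor uses_g_ex_gen)
  next
    case SC
    then show ?thesis
      using uses_g_Comp[of "nat_at \<mu> SC" "ex_gen Gc"] at[of SC] nat(2)
      by (simp add: ex_gen_Mor uses_g_ex_gen)
  qed simp
  obtain h where h: "h \<in> Mor exA" "Dom exA h = X" "Cod exA h = OL" "uses_g h \<longleftrightarrow> uses_g (nat_at \<mu> SB)"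
    using ex_Mor_into_OL[of "nat_at \<mu> SB" "nat_at \<mu> SC"] at[of SB] at[of SC] by auto
  \<comment> \<open>\<open>h\<close> was matched to the leg at \<open>SB\<close> only. The other
    components follow because they share its occurrence of g, which together with the ends
    determines a morphism.\<close>
  have "nat_at \<mu> i = ex_cone_at i \<odot>\<^bsub>exA\<^esub> h" for i
    using at[of i] h ex_cone_at_Mor[of i] exA.Comp_Mor[of h "ex_cone_at i"]
      uses[of i] uses[of SB] uses_g_ex_cone_whisker[of h i]
    by (intro Mor_exA_eqI) simp_all
  then have "\<mu> = ex_cone \<odot>\<^bsub>functor_twocat shape exA\<^esub> diag1 shape exA h"
    using \<mu> h by (intro twonat.equality)
      (auto simp: functor_twocat_simps diag1_def ex_cone_def)
  with h show ?thesis by blast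
qed

theorem mainTheorem6:
  shows "is_two_limit shape exA exF (OL, ex_cone) \<and>
    \<not> two_terminal (pseudo_slice shape exA exF) (OL, ex_cone)"
proof
  let ?w = "\<lambda>h. ex_cone \<odot>\<^bsub>functor_twocat shape exA\<^esub> diag1 shape exA h"
  show "is_two_limit shape exA exF (OL, ex_cone)"
  proof (rule cones.is_two_limitI[OF ex_cone_two_cones])
    fix X assume "X \<in> Obj exA"
    show "bij_betw ?w {h \<in> Mor exA. Dom exA h = X \<and> Cod exA h = OL}
      {\<mu> \<in> Mor (functor_twocat shape exA). nat_src \<mu> = diag0 shape exA X \<and> nat_tgt \<mu> = exF}"
      (is "bij_betw _ ?H ?C")
    proof (rule bij_betw_imageI)
      show "inj_on ?w ?H"
      proof (rule inj_onI)
        fix h k assume hk: "h \<in> ?H" "k \<in> ?H" "?w h = ?w k"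
        \<comment> \<open>A single component already decides whether the factorizing morphism
          involves g.\<close>
        have "ex_cone_at SB \<odot>\<^bsub>exA\<^esub> h = ex_cone_at SB \<odot>\<^bsub>exA\<^esub> k"
          using arg_cong[OF hk(3), of "\<lambda>\<mu>. nat_at \<mu> SB"] by (simp only: ex_cone_whisker)
        then have "uses_g h \<longleftrightarrow> uses_g k"
          using uses_g_ex_cone_whisker[of h SB] uses_g_ex_cone_whisker[of k SB] hk by simp
        then show "h = k"
          using hk by (intro Mor_exA_eqI) auto
      qed
      have "?w h \<in> ?C" if "h \<in> ?H" for h
        using that cones.whisker_cone_Mor[of ex_cone OL h] ex_cone_two_cones
        by (auto simp: two_cones_def functor_twocat_simps diag1_def)
      then show "?w ` ?H = ?C"
        using ex_cone_factorization by blast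
    qed
  qed
  have "ex_gen Gf \<noteq> ex_gen Gg"
    using uses_g_ex_gen[of Gf] uses_g_ex_gen[of Gg] by auto
  then show "\<not> two_terminal (pseudo_slice shape exA exF) (OL, ex_cone)"
    using cones.two_terminal_pseudo_sliceD[of exF OL ex_cone "ex_gen Gf" "ex_gen Gg"] ex_gen_Mor
    by auto
qed

end
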